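(* Let $\mathrm{MG}_2$ be the two-dimensional Mordell-Gruber spectrum and let $F_n$ be the Fibonacci numbers. Then: 1. $\min(\mathrm{MG}_2)=\frac{5+\sqrt5}{10}$; 2. $$\mathrm{MG}_2\cap\left(\frac{5+\sqrt5}{10},\frac{1+\sqrt5}{4}\right)=\left\{\frac{1+\sqrt{F_{2t}/F_{2t+2}}}{2} : t=1,2,\dots\right\};$$ 3. the smallest accumulation point of $\mathrm{MG}_2$ is $\frac{1+\sqrt5}{4}$, and $\frac{1+\sqrt5}{4}\in\mathrm{MG}_2$.
   Context: Fibonacci numbers: $F_0=0$, $F_1=1$, $F_{n+1}=F_n+F_{n-1}$. A unimodular lattice in $\mathbb{R}^2$ is $\Lambda=\mathbb{Z}A+\mathbb{Z}B$ with $|\det(A;B)|=1$. A rectangle $[-x,x]\times[-y,y]$ ($x,y>0$) is admissible in $\Lambda$ if its only point in $\Lambda$ is $(0,0)$; the Mordell constant is $\kappa(\Lambda)=\sup xy$ over all admissible rectangles, and $\mathrm{MG}_2=\{\kappa(\Lambda):\Lambda\text{ a unimodular lattice in }\mathbb{R}^2\}$. *)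

theory Defs
  imports "HOL-Analysis.Analysis" "HOL-Number_Theory.Fib"
begin

definition lattice_span :: "real^2 \<Rightarrow> real^2 \<Rightarrow> (real^2) set" where
  "lattice_span A B = {of_int m *\<^sub>R A + of_int n *\<^sub>R B | m n :: int. True}"

definition unimodular_lattice :: "(real^2) set \<Rightarrow> bool" where
  "unimodular_lattice L \<longleftrightarrow>
     (\<exists>A B. \<bar>det (vector [A, B] :: real^2^2)\<bar> = 1 \<and> L = lattice_span A B)"

definition rectangle :: "real \<Rightarrow> real \<Rightarrow> (real^2) set" where
  "rectangle x y = cbox (vector [-x, -y]) (vector [x, y])"

definition admissible :: "(real^2) set \<Rightarrow> real \<Rightarrow> real \<Rightarrow> bool" where
  "admissible L x y \<longleftrightarrow> x > 0 \<and> y > 0 \<and> rectangle x y \<inter> L = {0}"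

(* For a unimodular lattice the set below is nonempty (the lattice is discrete) and bounded
   above by 1 (Minkowski's convex body theorem), so Sup is a genuine supremum there. *)
definition mordell_constant :: "(real^2) set \<Rightarrow> real" where
  "mordell_constant L = Sup {x * y | x y. admissible L x y}"

definition MG2 :: "real set" where
  "MG2 = {mordell_constant L | L. unimodular_lattice L}"

end

theory Submission
  imports Defs
begin

text \<open>
  Let \<open>\<Lambda>\<close> be a unimodular lattice. A maximal box \<open>[-p, p] \<times> [-q, q]\<close> without nonzero lattice points in
  its interior has a lattice point on its right side and one on its upper side; these form a basis
  \<open>(p, \<plusminus> \<phi> q)\<close>, \<open>(\<minusplus> \<theta> p, q)\<close>, and the determinant condition reads \<open>p q (1 + \<theta> \<phi>) = 1\<close>. Such a
  \<^emph>\<open>cell\<close> exists around every admissible rectangle (\<open>admissible_inside_cell\<close>), and the Mordell constant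
  is the supremum of \<open>1 / (1 + \<theta> \<phi>)\<close> over the cells. Passing from one cell to the next one is a step of
  the continued fraction algorithm on \<open>\<theta>\<close>, while \<open>\<phi>\<close> collects the digits already consumed
  (\<open>cell_step\<close>). Thus a lattice is a bi-infinite sequence of digits, its cells are the cuts of this sequence,
  and a small Mordell constant means that the product \<open>\<theta> \<phi>\<close> of the two half expansions is large at every
  cut.

  Write \<open>g = (sqrt 5 - 1) / 2\<close>. The value \<open>(1 + sqrt 5) / 4\<close> corresponds to the product \<open>g^3 = 2 g - 1\<close>.
  If all products exceed it, all digits are 1 or 2 (\<open>digit_1_or_2\<close>), and the tails on both sides of a 2
  exceed \<open>g\<close> (\<open>both_above_golden\<close>). Since \<open>x \<mapsto> 1 / (1 + x)\<close> is decreasing and attracts to \<open>g\<close>, this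
  forces every 2 to be followed and preceded by an odd, finite number of ones and then by another 2. If
  the runs on the two sides of a 2 had different lengths, the tail with the longer run would be too close
  to \<open>g\<close> compared with the other one (\<open>longer_run_impossible\<close>). So all runs have the same length
  \<open>2 t - 1\<close>, or there is no 2 at all (\<open>gauss_closed_classification\<close>). The sequence of ones gives the minimum
  \<open>(5 + sqrt 5) / 10\<close>, and the periodic sequences give the values in the statement, through a quadratic
  equation with Fibonacci coefficients. A single 2 among ones attains \<open>(1 + sqrt 5) / 4\<close>, which is also
  the limit of the periodic values.

  To evaluate the Mordell constants of these lattices it suffices to exhibit a set of pairs
  \<open>(\<theta>, \<phi>)\<close> that is closed under the continued fraction step and under reversal: the minimal product in
  the set determines the constant (\<open>mordell_constant_closed_orbit\<close>).
\<close>

section \<open>Bases of plane lattices\<close>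

lemma mem_lattice_span_iff:
  "v \<in> lattice_span A B \<longleftrightarrow>
    (\<exists>(m::int) (n::int). v$1 = m * A$1 + n * B$1 \<and> v$2 = m * A$2 + n * B$2)"
  by (auto simp: lattice_span_def vec_eq_iff forall_2)

lemma zero_in_lattice_span: "0 \<in> lattice_span A B"
  unfolding mem_lattice_span_iff by (intro exI[of _ 0]) auto

lemma det_vector2: "det (vector [A, B] :: real^2^2) = A$1 * B$2 - A$2 * B$1"
  by (simp add: det_2)

lemma lattice_span_mono:
  fixes a b c d :: int
  shows "lattice_span (of_int a *\<^sub>R A + of_int b *\<^sub>R B) (of_int c *\<^sub>R A + of_int d *\<^sub>R B)
    \<subseteq> lattice_span A B"
proof
  fix v assume "v \<in> lattice_span (of_int a *\<^sub>R A + of_int b *\<^sub>R B) (of_int c *\<^sub>R A + of_int d *\<^sub>R B)"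
  then obtain m n :: int where
    "v = of_int m *\<^sub>R (of_int a *\<^sub>R A + of_int b *\<^sub>R B) + of_int n *\<^sub>R (of_int c *\<^sub>R A + of_int d *\<^sub>R B)"
    by (auto simp: lattice_span_def)
  then have "v = of_int (m * a + n * c) *\<^sub>R A + of_int (m * b + n * d) *\<^sub>R B"
    by (simp add: algebra_simps)
  then show "v \<in> lattice_span A B" unfolding lattice_span_def by blast
qed

lemma lattice_span_change_basis:
  fixes a b c d :: int
  assumes "\<bar>a * d - b * c\<bar> = 1"
    and A': "A' = of_int a *\<^sub>R A + of_int b *\<^sub>R B" and B': "B' = of_int c *\<^sub>R A + of_int d *\<^sub>R B"
  shows "lattice_span A' B' = lattice_span A B"
proof
  show "lattice_span A' B' \<subseteq> lattice_span A B" unfolding A' B' by (rule lattice_span_mono)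
  \<comment> \<open>The inverse of an integer matrix of determinant \<open>e = \<plusminus> 1\<close> is \<open>e\<close> times its adjugate.\<close>
  define e where "e = a * d - b * c"
  have e: "e * e = 1" using assms(1) unfolding e_def by (metis abs_mult_self_eq mult_1)
  have e': "of_int e * of_int e = (1::real)" using e by (metis of_int_1 of_int_mult)
  have re: "of_int e = real_of_int a * d - b * c" by (simp add: e_def)
  have 1: "A = of_int (e * d) *\<^sub>R A' + of_int (- (e * b)) *\<^sub>R B'"
  proof -
    have "of_int (e * d) *\<^sub>R A' + of_int (- (e * b)) *\<^sub>R B' = (of_int e * (real_of_int a * d - b * c)) *\<^sub>R A"
      unfolding A' B' by (simp add: algebra_simps)
    then show ?thesis using e' re by simp
  qed
  have 2: "B = of_int (- (e * c)) *\<^sub>R A' + of_int (e * a) *\<^sub>R B'"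
  proof -
    have "of_int (- (e * c)) *\<^sub>R A' + of_int (e * a) *\<^sub>R B' = (of_int e * (real_of_int a * d - b * c)) *\<^sub>R B"
      unfolding A' B' by (simp add: algebra_simps)
    then show ?thesis using e' re by simp
  qed
  show "lattice_span A B \<subseteq> lattice_span A' B'"
    using lattice_span_mono[of "e * d" A' "- (e * b)" B' "- (e * c)" "e * a"] 1 2 by simp
qed

lemma admissible_iff:
  assumes "0 \<in> L"
  shows "admissible L x y \<longleftrightarrow>
    x > 0 \<and> y > 0 \<and> (\<forall>v\<in>L. \<bar>v$1\<bar> \<le> x \<longrightarrow> \<bar>v$2\<bar> \<le> y \<longrightarrow> v = 0)"
proof -
  have "v \<in> rectangle x y \<longleftrightarrow> \<bar>v$1\<bar> \<le> x \<and> \<bar>v$2\<bar> \<le> y" for v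
    by (auto simp: rectangle_def mem_box_cart forall_2)
  then show ?thesis using assms unfolding admissible_def by auto
qed

text \<open>
  Exchanging the two coordinates reverses the direction in which the cells of a lattice are
  traversed, so every statement about the forward direction gives one about the backward direction.
\<close>

definition swap :: "real^2 \<Rightarrow> real^2" where
  "swap v = vector [v$2, v$1]"

lemma swap_nth [simp]: "swap v $ 1 = v$2" "swap v $ 2 = v$1"
  by (simp_all add: swap_def)

lemma swap_swap [simp]: "swap (swap v) = v"
  by (simp add: vec_eq_iff forall_2)

lemma swap_image_swap_image [simp]: "swap ` swap ` L = L"
  by (simp add: image_image)

lemma swap_eq_0_iff [simp]: "swap v = 0 \<longleftrightarrow> v = 0"
  by (auto simp: vec_eq_iff forall_2)

lemma swap_lattice_span: "swap ` lattice_span A B = lattice_span (swap A) (swap B)"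
proof -
  have *: "swap (of_int m *\<^sub>R A + of_int n *\<^sub>R B) = of_int m *\<^sub>R swap A + of_int n *\<^sub>R swap B" for m n :: int
    by (simp add: vec_eq_iff forall_2)
  have "swap ` lattice_span A B = {swap (of_int m *\<^sub>R A + of_int n *\<^sub>R B) | m n :: int. True}"
    unfolding lattice_span_def by blast
  then show ?thesis by (simp add: lattice_span_def *)
qed

lemma unimodular_lattice_zero: "unimodular_lattice L \<Longrightarrow> 0 \<in> L"
  by (auto simp: unimodular_lattice_def zero_in_lattice_span)

lemma zero_in_swap_image: "0 \<in> L \<Longrightarrow> 0 \<in> swap ` L"
  by (metis imageI swap_eq_0_iff)

lemma admissible_swap:
  assumes "0 \<in> L" "admissible L x y"
  shows "admissible (swap ` L) y x"
  using assms by (auto simp: admissible_iff zero_in_swap_image)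

lemma mordell_constant_swap:
  assumes "0 \<in> L"
  shows "mordell_constant (swap ` L) = mordell_constant L"
proof -
  have "{x * y | x y. admissible (swap ` L) x y} = {x * y | x y. admissible L x y}"
    (is "?l = ?r")
  proof (intro equalityI subsetI)
    fix z assume "z \<in> ?l"
    then obtain x y where "z = x * y" "admissible (swap ` L) x y" by blast
    then have "admissible L y x" "z = y * x"
      using admissible_swap[OF zero_in_swap_image[OF assms]] by auto
    then show "z \<in> ?r" by blast
  next
    fix z assume "z \<in> ?r"
    then obtain x y where "z = x * y" "admissible L x y" by blast
    then have "admissible (swap ` L) y x" "z = y * x"
      using admissible_swap[OF assms] by auto
    then show "z \<in> ?l" by blast
  qed
  then show ?thesis by (simp add: mordell_constant_def)
qed

section \<open>Cells of a lattice\<close>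

text \<open>
  The basis vectors are \<open>(p, \<plusminus> \<phi> q)\<close> and \<open>(\<minusplus> \<theta> p, q)\<close>. For \<open>\<theta>, \<phi> \<le> 1\<close> they lie on the right and on the
  upper side of the box \<open>[-p, p] \<times> [-q, q]\<close>, which is then a maximal box with empty interior. The opposite signs make the determinant \<open>p q (1 + \<theta> \<phi>)\<close>, and the
  ratios \<open>\<theta>\<close> and \<open>\<phi>\<close> are the two halves of a bi-infinite continued fraction, cut at the cell.
\<close>

definition cell :: "(real^2) set \<Rightarrow> real \<Rightarrow> real \<Rightarrow> real \<Rightarrow> real \<Rightarrow> bool" where
  "cell L \<theta> \<phi> p q \<longleftrightarrow> p > 0 \<and> q > 0 \<and> \<theta> \<ge> 0 \<and> \<phi> \<ge> 0 \<and> p * q * (1 + \<theta> * \<phi>) = 1 \<and>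
     (\<exists>s::int. s \<in> {1, -1} \<and> L = lattice_span (vector [p, of_int s * \<phi> * q]) (vector [- of_int s * \<theta> * p, q]))"

lemma cell_zero: "cell L \<theta> \<phi> p q \<Longrightarrow> 0 \<in> L"
  by (auto simp: cell_def zero_in_lattice_span)

lemma cell_basisE:
  assumes "cell L \<theta> \<phi> p q"
  obtains s :: int where "s \<in> {1, -1}"
    and "L = lattice_span (vector [p, of_int s * \<phi> * q]) (vector [- of_int s * \<theta> * p, q])"
  using assms unfolding cell_def by (elim conjE exE) (rule that)

lemma cell_area:
  assumes "cell L \<theta> \<phi> p q"
  shows "p * q = 1 / (1 + \<theta> * \<phi>)"
proof -
  have "1 + \<theta> * \<phi> > 0" using assms by (simp add: cell_def add_pos_nonneg)
  then show ?thesis using assms by (simp add: cell_def field_simps)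
qed

lemma cell_unimodular:
  assumes "cell L \<theta> \<phi> p q"
  shows "unimodular_lattice L"
proof -
  obtain s :: int where s: "s \<in> {1, -1}" and L: "L = lattice_span (vector [p, of_int s * \<phi> * q]) (vector [- of_int s * \<theta> * p, q])"
    using assms by (rule cell_basisE)
  have "det (vector [vector [p, of_int s * \<phi> * q], vector [- of_int s * \<theta> * p, q]] :: real^2^2) =
      p * q + of_int (s * s) * (p * q * (\<theta> * \<phi>))"
    by (simp add: det_vector2)
  also have "s * s = 1" using s by auto
  also have "p * q + of_int 1 * (p * q * (\<theta> * \<phi>)) = 1"
    using assms by (simp add: cell_def distrib_left)
  finally have "\<bar>det (vector [vector [p, of_int s * \<phi> * q], vector [- of_int s * \<theta> * p, q]] :: real^2^2)\<bar> = 1"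
    by simp
  then show ?thesis using L unfolding unimodular_lattice_def by blast
qed

lemma exists_cell:
  assumes "\<theta> \<ge> 0" "\<phi> \<ge> 0"
  shows "\<exists>L p q. cell L \<theta> \<phi> p q"
proof -
  have "1 + \<theta> * \<phi> > 0" using assms by (simp add: add_pos_nonneg)
  then have "cell (lattice_span (vector [1, 1 * \<phi> * (1 / (1 + \<theta> * \<phi>))]) (vector [- 1 * \<theta> * 1, 1 / (1 + \<theta> * \<phi>)]))
    \<theta> \<phi> 1 (1 / (1 + \<theta> * \<phi>))"
    using assms unfolding cell_def by (auto intro!: exI[of _ "1::int"])
  then show ?thesis by blast
qed

lemma cell_swap:
  assumes "cell L \<theta> \<phi> p q"
  shows "cell (swap ` L) \<phi> \<theta> q p"
proof -
  obtain s :: int where s: "s \<in> {1, -1}" and L: "L = lattice_span (vector [p, of_int s * \<phi> * q]) (vector [- of_int s * \<theta> * p, q])"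
    using assms by (rule cell_basisE)
  have "swap ` L = lattice_span (swap (vector [p, of_int s * \<phi> * q])) (swap (vector [- of_int s * \<theta> * p, q]))"
    by (simp add: L swap_lattice_span)
  also have "\<dots> = lattice_span (vector [q, of_int (- s) * \<theta> * p]) (vector [- of_int (- s) * \<phi> * q, p])"
    by (rule lattice_span_change_basis[of 0 0 1 1]) (auto simp: vec_eq_iff forall_2)
  finally have "swap ` L = lattice_span (vector [q, of_int (- s) * \<theta> * p]) (vector [- of_int (- s) * \<phi> * q, p])" .
  moreover have "- s \<in> {1, -1}" using s by auto
  ultimately show ?thesis using assms unfolding cell_def by (auto simp: mult.commute)
qed

text \<open>
  One step of the continued fraction algorithm: the vector of height \<open>q\<close> becomes the first basis
  vector, and \<open>a\<close> copies of it are added to the old first vector, which moves the digit \<open>a\<close> from the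
  expansion of \<open>\<theta>\<close> to that of \<open>\<phi>\<close>. Any \<open>a\<close> that leaves \<open>1 / \<theta> - a\<close> nonnegative gives a cell.
\<close>

lemma cell_step:
  fixes a :: int and \<theta> \<phi> p q :: real
  assumes c: "cell L \<theta> \<phi> p q" and th: "\<theta> > 0" and a: "1 \<le> a" and le: "of_int a \<le> 1 / \<theta>"
  shows "cell L (1 / \<theta> - a) (1 / (a + \<phi>)) (\<theta> * p) (q * (a + \<phi>))"
proof -
  obtain s :: int where s: "s \<in> {1, -1}" and L: "L = lattice_span (vector [p, of_int s * \<phi> * q]) (vector [- of_int s * \<theta> * p, q])"
    using c by (rule cell_basisE)
  have pos: "p > 0" "q > 0" "\<phi> \<ge> 0" "p * q * (1 + \<theta> * \<phi>) = 1" using c by (auto simp: cell_def)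
  have ap: "a + \<phi> > 0" using a pos by (simp add: add_pos_nonneg)
  have ss: "s * s = 1" using s by auto
  have ss': "real_of_int s * s = 1" using ss by (metis of_int_1 of_int_mult)
  have ss'': "real_of_int s * (of_int s * x) = x" for x :: real using ss' by (simp flip: mult.assoc)
  let ?A = "vector [p, of_int s * \<phi> * q] :: real^2" and ?B = "vector [- of_int s * \<theta> * p, q] :: real^2"
  have "lattice_span (vector [\<theta> * p, of_int (- s) * (1 / (a + \<phi>)) * (q * (a + \<phi>))])
       (vector [- of_int (- s) * (1 / \<theta> - a) * (\<theta> * p), q * (a + \<phi>)]) = L"
    unfolding L
  proof (rule lattice_span_change_basis)
    show "\<bar>0 * a - (- s) * s\<bar> = 1" using ss by simp
    have "of_int (- s) * (1 / (a + \<phi>)) * (q * (a + \<phi>)) = of_int (- s) * q"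
      using ap by simp
    moreover have "of_int (- s) * (- of_int s * \<theta> * p) = \<theta> * p"
      using ss''[of "\<theta> * p"] by (simp add: mult.assoc)
    ultimately show "vector [\<theta> * p, of_int (- s) * (1 / (a + \<phi>)) * (q * (a + \<phi>))] =
      of_int 0 *\<^sub>R ?A + of_int (- s) *\<^sub>R ?B"
      by (simp add: vec_eq_iff forall_2)
    have e: "(1 / \<theta> - a) * (\<theta> * p) = p - a * (\<theta> * p)"
      using th by (simp add: left_diff_distrib)
    have "- of_int (- s) * (1 / \<theta> - a) * (\<theta> * p) = of_int s * ((1 / \<theta> - a) * (\<theta> * p))"
      by simp
    also have "\<dots> = of_int s * p + a * (- of_int s * \<theta> * p)"
      unfolding e by (simp add: right_diff_distrib)
    finally have "- of_int (- s) * (1 / \<theta> - a) * (\<theta> * p) = of_int s * p + a * (- of_int s * \<theta> * p)" .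
    moreover have "q * (a + \<phi>) = of_int s * (of_int s * \<phi> * q) + a * q"
      using ss''[of "\<phi> * q"] by (simp add: mult.assoc distrib_left mult.commute)
    ultimately show "vector [- of_int (- s) * (1 / \<theta> - a) * (\<theta> * p), q * (a + \<phi>)] =
      of_int s *\<^sub>R ?A + of_int a *\<^sub>R ?B"
      by (simp add: vec_eq_iff forall_2)
  qed
  moreover have "\<theta> * p * (q * (a + \<phi>)) * (1 + (1 / \<theta> - a) * (1 / (a + \<phi>))) = p * q * (1 + \<theta> * \<phi>)"
    (is "?l = ?r")
  proof -
    have "1 + (1 / \<theta> - a) * (1 / (a + \<phi>)) = (\<phi> + 1 / \<theta>) / (a + \<phi>)"
    proof -
      have "1 + x * (1 / y) = (y + x) / y" if "y > 0" for x y :: real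
        using that by (simp add: add_divide_distrib)
      from this[OF ap] show ?thesis by simp
    qed
    then have "?l = \<theta> * p * q * (\<phi> + 1 / \<theta>)" using ap by simp
    also have "\<dots> = ?r" using th by (simp add: algebra_simps)
    finally show ?thesis .
  qed
  moreover have "- s \<in> {1, -1}" using s by auto
  ultimately show ?thesis
    unfolding cell_def using pos ap th le by (intro conjI exI[of _ "- s"]) simp_all
qed

text \<open>
  A lattice point \<open>m A + n B\<close> of the cell basis has coordinates of absolute value \<open>\<bar>m - k \<theta>\<bar> p\<close> and
  \<open>\<bar>k + m \<phi>\<bar> q\<close> with \<open>k = \<plusminus> n\<close>. If \<open>k \<noteq> 0\<close> and \<open>m k \<ge> 0\<close>, the second is at least \<open>q\<close>; for all other
  nonzero points the first is at least \<open>p\<close>.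
\<close>

lemma cell_admissible:
  assumes c: "cell L \<theta> \<phi> p q" and x: "0 < x" "x < p" and y: "0 < y" "y < q"
  shows "admissible L x y"
proof -
  obtain s :: int where s: "s \<in> {1, -1}" and L: "L = lattice_span (vector [p, of_int s * \<phi> * q]) (vector [- of_int s * \<theta> * p, q])"
    using c by (rule cell_basisE)
  have pos: "p > 0" "q > 0" "\<phi> \<ge> 0" "\<theta> \<ge> 0" using c by (auto simp: cell_def)
  have "v = 0" if v: "v \<in> L" "\<bar>v$1\<bar> \<le> x" "\<bar>v$2\<bar> \<le> y" for v
  proof -
    obtain m n :: int where 1: "v$1 = m * p + n * (- s * \<theta> * p)" and 2: "v$2 = m * (s * \<phi> * q) + n * q"
      using v(1) unfolding L by (auto simp: mem_lattice_span_iff)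
    define k where "k = s * n"
    have n: "n = s * k" using s by (auto simp: k_def)
    have v1: "v$1 = (m - k * \<theta>) * p" using 1 s by (auto simp: n algebra_simps)
    have v2: "v$2 = s * (k + m * \<phi>) * q" using 2 s by (auto simp: n algebra_simps)
    have "\<bar>m - k * \<theta>\<bar> * p \<le> x" using v(2) pos v1 by (simp add: abs_mult)
    then have "\<bar>m - k * \<theta>\<bar> * p < 1 * p" using x by linarith
    then have b1: "\<bar>m - k * \<theta>\<bar> < 1" using pos(1) by (rule mult_right_less_imp_less[OF _ less_imp_le])
    have "\<bar>k + m * \<phi>\<bar> * q \<le> y" using v(3) pos v2 s by (auto simp: abs_mult)
    then have "\<bar>k + m * \<phi>\<bar> * q < 1 * q" using y by linarith
    then have b2: "\<bar>k + m * \<phi>\<bar> < 1" using pos(2) by (rule mult_right_less_imp_less[OF _ less_imp_le])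
    have mk: "m = 0 \<and> k = 0"
    proof -
      have A: False if "m \<ge> 1" "k \<le> 0"
      proof -
        have "k * \<theta> \<le> 0" using that pos by (simp add: mult_nonpos_nonneg)
        then show False using b1 that by linarith
      qed
      have B: False if "m \<le> -1" "k \<ge> 0"
      proof -
        have "k * \<theta> \<ge> 0" using that pos by simp
        then show False using b1 that by linarith
      qed
      have C: False if "k \<ge> 1" "m \<ge> 0"
      proof -
        have "m * \<phi> \<ge> 0" using that pos by simp
        then show False using b2 that by linarith
      qed
      have D: False if "k \<le> -1" "m \<le> 0"
      proof -
        have "m * \<phi> \<le> 0" using that pos by (simp add: mult_nonpos_nonneg)
        then show False using b2 that by linarith
      qed
      show ?thesis using A B C D by (smt (verit))
    qed
    then show "v = 0" using v1 v2 by (simp add: vec_eq_iff forall_2)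
  qed
  then show ?thesis using x y by (auto simp: admissible_iff[OF cell_zero[OF c]])
qed

lemma cell_point_blocks:
  assumes c: "cell L \<theta> \<phi> p q" and adm: "admissible L x y" and x: "p \<le> x"
  shows "y < \<phi> * q"
proof (rule ccontr)
  assume "\<not> y < \<phi> * q"
  obtain s :: int where s: "s \<in> {1, -1}" and L: "L = lattice_span (vector [p, of_int s * \<phi> * q]) (vector [- of_int s * \<theta> * p, q])"
    using c by (rule cell_basisE)
  have pos: "p > 0" "q > 0" "\<phi> \<ge> 0" "\<theta> \<ge> 0" using c by (auto simp: cell_def)
  define v :: "real^2" where "v = vector [p, of_int s * \<phi> * q]"
  have "v \<in> L" unfolding L v_def mem_lattice_span_iff by (intro exI[of _ 1] exI[of _ 0]) auto
  moreover have "\<bar>v$1\<bar> \<le> x" "\<bar>v$2\<bar> \<le> y" using \<open>\<not> y < \<phi> * q\<close> s x pos by (auto simp: v_def)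
  ultimately have "v = 0" using adm by (auto simp: admissible_iff[OF cell_zero[OF c]])
  then have "v$1 = 0" by simp
  then show False using pos by (simp add: v_def)
qed

text \<open>
  Any complement \<open>B\<close> of \<open>A\<close> can be shifted by multiples of \<open>A\<close> until its first coordinate is shorter
  than that of \<open>A\<close>; minimality of \<open>A\<close> then forces its second coordinate to be long. The determinant is
  dominated by the product of the two long coordinates, which fixes the sign of the second one.
\<close>

lemma cell_from_minimal_vector:
  assumes L: "L = lattice_span A B" and det: "\<bar>det (vector [A, B] :: real^2^2)\<bar> = 1"
    and A1: "A$1 > 0" and A2: "\<bar>A$2\<bar> \<le> Y" and Y: "Y > 0"
    and least: "\<And>v. v \<in> L \<Longrightarrow> v \<noteq> 0 \<Longrightarrow> \<bar>v$1\<bar> < A$1 \<Longrightarrow> Y \<le> \<bar>v$2\<bar>"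
  shows "\<exists>\<theta> \<phi> q. cell L \<theta> \<phi> (A$1) q \<and> Y \<le> q \<and> \<theta> < 1 \<and> \<phi> \<le> 1"
proof -
  define p where "p = A$1"
  define s :: int where "s = (if A$2 \<ge> 0 then 1 else -1)"
  have s: "s \<in> {1, -1}" by (simp add: s_def)
  \<comment> \<open>Changing the sign of \<open>B\<close> makes the determinant equal to 1.\<close>
  define e :: int where "e = (if det (vector [A, B] :: real^2^2) > 0 then 1 else -1)"
  have e: "\<bar>e\<bar> = 1" by (simp add: e_def)
  have edet: "e * det (vector [A, B] :: real^2^2) = 1"
    using det by (auto simp: e_def)
  \<comment> \<open>Rounding the first coordinate of the second basis vector on the side prescribed by \<open>s\<close>
    makes the off-diagonal entries of the basis have opposite signs.\<close>
  define n where "n = (if s = 1 then - \<lceil>e * B$1 / p\<rceil> else - \<lfloor>e * B$1 / p\<rfloor>)"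
  define C where "C = of_int n *\<^sub>R A + of_int e *\<^sub>R B"
  have LC: "L = lattice_span A C"
    unfolding L by (rule lattice_span_change_basis[of 1 e 0 n, symmetric]) (use e in \<open>auto simp: C_def\<close>)
  have p: "p > 0" using A1 by (simp add: p_def)
  have detC: "p * C$2 - A$2 * C$1 = 1"
    using edet by (simp add: C_def det_vector2 p_def algebra_simps)
  define \<theta> where "\<theta> = - s * C$1 / p"
  have C1: "C$1 = - of_int s * \<theta> * p" using s p by (auto simp: \<theta>_def)
  have C1': "C$1 = p * (n + e * B$1 / p)" using p by (simp add: C_def p_def field_simps)
  have th': "\<theta> = - s * (n + e * B$1 / p)" using p by (simp add: \<theta>_def C1')
  have th: "0 \<le> \<theta>" "\<theta> < 1"
  proof -
    define t where "t = e * B$1 / p"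
    have "\<theta> = (if s = 1 then \<lceil>t\<rceil> - t else t - \<lfloor>t\<rfloor>)"
      using s unfolding th' n_def t_def[symmetric] by auto
    then show "0 \<le> \<theta>" "\<theta> < 1" by (simp_all, linarith+)
  qed
  have A2': "A$2 = of_int s * \<bar>A$2\<bar>" by (simp add: s_def)
  have absC1: "\<bar>C$1\<bar> = \<theta> * p" using C1 s th p by (auto simp: abs_mult)
  have C0: "C \<noteq> 0" using detC by auto
  have "C \<in> L" unfolding LC mem_lattice_span_iff by (intro exI[of _ 0] exI[of _ 1]) auto
  moreover have "\<bar>C$1\<bar> < A$1" using absC1 th p by (simp add: p_def)
  ultimately have C2: "Y \<le> \<bar>C$2\<bar>" using least C0 by blast
  have prod: "A$2 * C$1 = - (\<bar>A$2\<bar> * \<theta> * p)" 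
  proof -
    have "A$2 * C$1 = (of_int s * \<bar>A$2\<bar>) * (- of_int s * \<theta> * p)" by (simp only: A2'[symmetric] C1[symmetric])
    also have "\<dots> = - (of_int (s * s) * (\<bar>A$2\<bar> * \<theta> * p))" by simp
    also have "s * s = 1" using s by auto
    finally show ?thesis by simp
  qed
  have pos: "C$2 > 0"
  proof (rule ccontr)
    assume "\<not> C$2 > 0"
    then have "C$2 \<le> - Y" using C2 by linarith
    then have "p * C$2 \<le> p * - Y" using p by (intro mult_left_mono) auto
    moreover have "\<bar>A$2\<bar> * \<theta> * p \<le> Y * 1 * p"
      using A2 th p Y by (intro mult_mono) auto
    ultimately show False using detC prod by (simp add: mult.commute)
  qed
  define q where "q = C$2"
  define \<phi> where "\<phi> = \<bar>A$2\<bar> / q"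
  have q: "q > 0" "Y \<le> q" using pos C2 by (auto simp: q_def)
  have phi: "\<phi> \<ge> 0" "\<phi> \<le> 1" using q A2 by (auto simp: \<phi>_def field_simps)
  have A_eq: "A = vector [p, of_int s * \<phi> * q]"
    using q A2' by (simp add: vec_eq_iff forall_2 p_def \<phi>_def)
  have C_eq: "C = vector [- of_int s * \<theta> * p, q]"
    using C1 by (simp add: vec_eq_iff forall_2 q_def)
  have area: "p * q * (1 + \<theta> * \<phi>) = 1"
  proof -
    have "\<phi> * q = \<bar>A$2\<bar>" using q by (simp add: \<phi>_def)
    then have "p * q * (1 + \<theta> * \<phi>) = p * q + \<bar>A$2\<bar> * \<theta> * p" by (simp add: algebra_simps)
    then show ?thesis using detC prod by (simp add: q_def)
  qed
  have "L = lattice_span (vector [p, of_int s * \<phi> * q]) (vector [- of_int s * \<theta> * p, q])"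
    using LC unfolding A_eq[symmetric] C_eq[symmetric] .
  then have "cell L \<theta> \<phi> p q"
    unfolding cell_def using p q th phi s area by (intro conjI exI[of _ s])
  then show ?thesis using q th phi by (auto simp: p_def)
qed

text \<open>
  Cramer's rule with determinant \<open>\<plusminus> 1\<close>.
\<close>

lemma lattice_coordinates:
  assumes det: "\<bar>det (vector [A, B] :: real^2^2)\<bar> = 1"
    and v: "v = of_int m *\<^sub>R A + of_int n *\<^sub>R B" and b: "\<bar>v$1\<bar> \<le> X" "\<bar>v$2\<bar> \<le> Y"
  shows "\<bar>of_int m\<bar> \<le> X * \<bar>B$2\<bar> + Y * \<bar>B$1\<bar>" "\<bar>of_int n\<bar> \<le> X * \<bar>A$2\<bar> + Y * \<bar>A$1\<bar>"
proof -
  define D where "D = det (vector [A, B] :: real^2^2)"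
  have D: "\<bar>D\<bar> = 1" using det by (simp add: D_def)
  have 1: "of_int m * D = v$1 * B$2 - v$2 * B$1"
    by (simp add: v D_def det_vector2 algebra_simps)
  have 2: "of_int n * D = v$2 * A$1 - v$1 * A$2"
    by (simp add: v D_def det_vector2 algebra_simps)
  have bound: "\<bar>x * c - y * d\<bar> \<le> P * \<bar>c\<bar> + Q * \<bar>d\<bar>" if "\<bar>x\<bar> \<le> P" "\<bar>y\<bar> \<le> Q" for x y c d P Q :: real
  proof -
    have "\<bar>x * c - y * d\<bar> \<le> \<bar>x\<bar> * \<bar>c\<bar> + \<bar>y\<bar> * \<bar>d\<bar>"
      by (metis abs_mult abs_triangle_ineq4)
    also have "\<dots> \<le> P * \<bar>c\<bar> + Q * \<bar>d\<bar>"
      using that by (intro add_mono mult_right_mono) auto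
    finally show ?thesis .
  qed
  have "\<bar>of_int m\<bar> = \<bar>of_int m * D\<bar>" using D by (simp add: abs_mult)
  also have "\<dots> \<le> X * \<bar>B$2\<bar> + Y * \<bar>B$1\<bar>" unfolding 1 by (rule bound[OF b])
  finally show "\<bar>of_int m\<bar> \<le> X * \<bar>B$2\<bar> + Y * \<bar>B$1\<bar>" .
  have "\<bar>of_int n\<bar> = \<bar>of_int n * D\<bar>" using D by (simp add: abs_mult)
  also have "\<dots> \<le> Y * \<bar>A$1\<bar> + X * \<bar>A$2\<bar>" unfolding 2 by (rule bound[OF b(2) b(1)])
  finally show "\<bar>of_int n\<bar> \<le> X * \<bar>A$2\<bar> + Y * \<bar>A$1\<bar>" by simp
qed

lemma lattice_locally_finite:
  assumes det: "\<bar>det (vector [A, B] :: real^2^2)\<bar> = 1"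
  shows "finite {v \<in> lattice_span A B. \<bar>v$1\<bar> \<le> X \<and> \<bar>v$2\<bar> \<le> Y}"
proof -
  define M where "M = \<lceil>X * \<bar>B$2\<bar> + Y * \<bar>B$1\<bar>\<rceil>"
  define N where "N = \<lceil>X * \<bar>A$2\<bar> + Y * \<bar>A$1\<bar>\<rceil>"
  have "{v \<in> lattice_span A B. \<bar>v$1\<bar> \<le> X \<and> \<bar>v$2\<bar> \<le> Y} \<subseteq>
    (\<lambda>(m, n). of_int m *\<^sub>R A + of_int n *\<^sub>R B) ` ({-M..M} \<times> {-N..N})"
  proof
    fix v assume "v \<in> {v \<in> lattice_span A B. \<bar>v$1\<bar> \<le> X \<and> \<bar>v$2\<bar> \<le> Y}"
    then obtain m n :: int where v: "v = of_int m *\<^sub>R A + of_int n *\<^sub>R B" "\<bar>v$1\<bar> \<le> X" "\<bar>v$2\<bar> \<le> Y"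
      by (auto simp: lattice_span_def)
    have "\<bar>m\<bar> \<le> M" "\<bar>n\<bar> \<le> N"
      using lattice_coordinates[OF det v] unfolding M_def N_def by linarith+
    then show "v \<in> (\<lambda>(m, n). of_int m *\<^sub>R A + of_int n *\<^sub>R B) ` ({-M..M} \<times> {-N..N})"
      using v(1) by (intro image_eqI[of _ _ "(m, n)"]) auto
  qed
  then show ?thesis by (rule finite_subset) simp
qed

lemma unimodular_has_admissible:
  assumes "unimodular_lattice L"
  shows "\<exists>x. admissible L x x"
proof -
  obtain A B where det: "\<bar>det (vector [A, B] :: real^2^2)\<bar> = 1" and L: "L = lattice_span A B"
    using assms by (auto simp: unimodular_lattice_def)
  define F where "F = {v \<in> L. \<bar>v$1\<bar> \<le> 1 \<and> \<bar>v$2\<bar> \<le> 1} - {0}"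
  have fin: "finite F" unfolding F_def L using lattice_locally_finite[OF det] by blast
  define r where "r = Min (insert 1 ((\<lambda>v. max \<bar>v$1\<bar> \<bar>v$2\<bar>) ` F))"
  have "r > 0"
    unfolding r_def using fin
    by (subst Min_gr_iff) (auto simp: F_def vec_eq_iff forall_2 less_max_iff_disj)
  moreover have "r \<le> 1" unfolding r_def using fin by (intro Min_le) auto
  moreover have "v = 0" if "v \<in> L" "\<bar>v$1\<bar> \<le> r/2" "\<bar>v$2\<bar> \<le> r/2" for v
  proof (rule ccontr)
    assume "v \<noteq> 0"
    then have "v \<in> F" using that \<open>r \<le> 1\<close> \<open>r > 0\<close> by (auto simp: F_def)
    then have "r \<le> max \<bar>v$1\<bar> \<bar>v$2\<bar>" unfolding r_def using fin by (intro Min_le) auto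
    then show False using that \<open>r > 0\<close> by auto
  qed
  ultimately have "admissible L (r/2) (r/2)"
    by (subst admissible_iff[OF unimodular_lattice_zero[OF assms]]) auto
  then show ?thesis by blast
qed

text \<open>
  A vector that minimises a positively homogeneous size is primitive, since dividing it by the gcd
  of its coordinates would make it smaller; Bezout's identity completes a primitive vector to a basis.
\<close>

lemma lattice_minimal_basis:
  fixes N :: "real^2 \<Rightarrow> real"
  assumes det: "\<bar>det (vector [A, B] :: real^2^2)\<bar> = 1"
    and C: "C \<in> lattice_span A B" "C \<noteq> 0"
    and min: "\<And>v. v \<in> lattice_span A B \<Longrightarrow> v \<noteq> 0 \<Longrightarrow> N C \<le> N v"
    and N: "\<And>v. v \<noteq> 0 \<Longrightarrow> N v > 0" "\<And>r v. r > 0 \<Longrightarrow> N (r *\<^sub>R v) = r * N v"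
  shows "\<exists>D. \<bar>det (vector [C, D] :: real^2^2)\<bar> = 1 \<and> lattice_span A B = lattice_span C D"
proof -
  obtain m n :: int where C_eq: "C = of_int m *\<^sub>R A + of_int n *\<^sub>R B"
    using C(1) by (auto simp: lattice_span_def)
  define d where "d = gcd m n"
  have "d \<noteq> 0" using C(2) by (auto simp: d_def C_eq)
  then have d: "d \<ge> 1" unfolding d_def using gcd_ge_0_int[of m n] by linarith
  obtain m' n' where mn: "m = d * m'" "n = d * n'" unfolding d_def by (metis dvdE gcd_dvd1 gcd_dvd2)
  define v where "v = of_int m' *\<^sub>R A + of_int n' *\<^sub>R B"
  have Cv: "C = of_int d *\<^sub>R v" by (simp add: C_eq mn v_def algebra_simps)
  have "v \<noteq> 0" using C(2) Cv by auto
  moreover have "v \<in> lattice_span A B" unfolding v_def lattice_span_def by blast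
  ultimately have "of_int d * N v \<le> 1 * N v" "N v > 0" using min[of v] N d by (auto simp: Cv)
  then have "d = 1" using d by (simp add: mult_le_cancel_right_pos)
  then obtain u w where uw: "u * m + w * n = 1" using bezout_int[of m n] by (auto simp: d_def)
  define D where "D = of_int (- w) *\<^sub>R A + of_int u *\<^sub>R B"
  have "lattice_span C D = lattice_span A B"
    by (rule lattice_span_change_basis[OF _ C_eq D_def]) (use uw in \<open>simp add: algebra_simps\<close>)
  moreover have "det (vector [C, D] :: real^2^2) = of_int (u * m + w * n) * det (vector [A, B] :: real^2^2)"
    by (simp add: det_vector2 C_eq D_def algebra_simps)
  ultimately show ?thesis using uw det by (intro exI[of _ D]) auto
qed

text \<open>
  Enlarge the given box homothetically until it first meets a nonzero lattice point. That point lies on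
  a vertical or a horizontal side, and it is the minimal vector from which the cell is built. Hence
  cells capture all admissible boxes, which also yields the bound 1 on their quarter areas.
\<close>

lemma admissible_inside_cell:
  assumes uni: "unimodular_lattice L" and adm: "admissible L x y"
  shows "\<exists>\<theta> \<phi> p q. cell L \<theta> \<phi> p q \<and> x < p \<and> y < q \<and> \<theta> \<le> 1 \<and> \<phi> \<le> 1"
proof -
  obtain A B where det: "\<bar>det (vector [A, B] :: real^2^2)\<bar> = 1" and L: "L = lattice_span A B"
    using uni by (auto simp: unimodular_lattice_def)
  have xy: "x > 0" "y > 0" and empty: "\<And>v. v \<in> L \<Longrightarrow> \<bar>v$1\<bar> \<le> x \<Longrightarrow> \<bar>v$2\<bar> \<le> y \<Longrightarrow> v = 0"
    using adm by (auto simp: admissible_iff[OF unimodular_lattice_zero[OF uni]])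
  define N where "N v = max (\<bar>v$1\<bar> / x) (\<bar>v$2\<bar> / y)" for v :: "real^2"
  have N_le: "N v \<le> r \<longleftrightarrow> \<bar>v$1\<bar> \<le> r * x \<and> \<bar>v$2\<bar> \<le> r * y" for v r
    using xy by (auto simp: N_def field_simps)
  have N_less: "N v < r \<longleftrightarrow> \<bar>v$1\<bar> < r * x \<and> \<bar>v$2\<bar> < r * y" for v r
    using xy by (auto simp: N_def field_simps)
  have N_pos: "N v > 0" if "v \<noteq> 0" for v
    using that xy by (auto simp: N_def vec_eq_iff forall_2 less_max_iff_disj)
  have N_scale: "N (r *\<^sub>R v) = r * N v" if "r > 0" for r v
    using that xy by (auto simp: N_def abs_mult max_mult_distrib_left)
  have A: "A \<in> L" unfolding L mem_lattice_span_iff by (intro exI[of _ 1] exI[of _ 0]) auto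
  have A0: "A \<noteq> 0" using det by (auto simp: det_vector2)
  define F where "F = {v \<in> L. N v \<le> N A} - {0}"
  have "finite F" unfolding F_def L N_le using lattice_locally_finite[OF det] by simp
  moreover have "A \<in> F" using A A0 by (auto simp: F_def)
  ultimately obtain C where C: "C \<in> F" and C_min: "\<And>v. v \<in> F \<Longrightarrow> N C \<le> N v"
    by (metis arg_min_if_finite(1) arg_min_least empty_iff)
  have CL: "C \<in> L" "C \<noteq> 0" using C by (auto simp: F_def)
  have min: "N C \<le> N v" if "v \<in> L" "v \<noteq> 0" for v
    using C_min[of v] C that by (cases "N v \<le> N A") (auto simp: F_def)
  obtain D where D: "\<bar>det (vector [C, D] :: real^2^2)\<bar> = 1" "L = lattice_span C D"
    using lattice_minimal_basis[OF det, of C N] CL min N_pos N_scale unfolding L by blast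
  define r where "r = N C"
  have r1: "r > 1"
    using empty[of C] CL N_le[of C 1] by (force simp: r_def)
  have least: "r * x \<le> \<bar>v$1\<bar> \<or> r * y \<le> \<bar>v$2\<bar>" if "v \<in> L" "v \<noteq> 0" for v
    using min[OF that] N_less[of v r] by (auto simp: r_def)
  have Cle: "\<bar>C$1\<bar> \<le> r * x" "\<bar>C$2\<bar> \<le> r * y" using N_le[of C r] by (auto simp: r_def)
  have rxy: "x < r * x" "y < r * y" using r1 xy by auto
  have signed: "\<exists>C' D'. \<bar>det (vector [C', D'] :: real^2^2)\<bar> = 1 \<and> L = lattice_span C' D' \<and> C' = of_int k *\<^sub>R C"
    if k: "\<bar>k\<bar> = 1" for k :: int
  proof -
    have "lattice_span (of_int k *\<^sub>R C) D = lattice_span C D"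
      by (rule lattice_span_change_basis[of k 1 0 0]) (use k in auto)
    moreover have "det (vector [of_int k *\<^sub>R C, D] :: real^2^2) = of_int k * det (vector [C, D] :: real^2^2)"
      by (simp add: det_vector2 right_diff_distrib)
    then have "\<bar>det (vector [of_int k *\<^sub>R C, D] :: real^2^2)\<bar> = 1"
      using D(1) k by (simp only: abs_mult of_int_abs[symmetric])
    ultimately show ?thesis using D(2) by blast
  qed
  consider "\<bar>C$1\<bar> = r * x" | "\<bar>C$2\<bar> = r * y"
    using Cle N_less[of C r] by (force simp: r_def)
  then show ?thesis
  proof cases
    case 1
    define e :: int where "e = (if C$1 > 0 then 1 else -1)"
    have e: "\<bar>e\<bar> = 1" by (simp add: e_def)
    obtain C' D' where C': "\<bar>det (vector [C', D'] :: real^2^2)\<bar> = 1" "L = lattice_span C' D'" "C' = of_int e *\<^sub>R C"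
      using signed[OF e] by blast
    have c1: "C'$1 = r * x" using 1 by (auto simp: C'(3) e_def)
    have c2: "\<bar>C'$2\<bar> \<le> r * y" using Cle by (auto simp: C'(3) e_def)
    have "\<exists>\<theta> \<phi> q. cell L \<theta> \<phi> (C'$1) q \<and> r * y \<le> q \<and> \<theta> < 1 \<and> \<phi> \<le> 1"
    proof (rule cell_from_minimal_vector[OF C'(2,1)])
      show "r * y \<le> \<bar>v$2\<bar>" if "v \<in> L" "v \<noteq> 0" "\<bar>v$1\<bar> < C' $ 1" for v
        using that(3) least[OF that(1,2)] c1 by linarith
    qed (use c1 c2 rxy xy in linarith)+
    then obtain \<theta> \<phi> q where cell: "cell L \<theta> \<phi> (r * x) q" and b: "r * y \<le> q" "\<theta> < 1" "\<phi> \<le> 1"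
      unfolding c1 by blast
    show ?thesis
      using cell by (intro exI[of _ \<theta>] exI[of _ \<phi>] exI[of _ "r * x"] exI[of _ q]) (use b rxy in auto)
  next
    case 2
    define e :: int where "e = (if C$2 > 0 then 1 else -1)"
    have e: "\<bar>e\<bar> = 1" by (simp add: e_def)
    obtain C' D' where C': "\<bar>det (vector [C', D'] :: real^2^2)\<bar> = 1" "L = lattice_span C' D'" "C' = of_int e *\<^sub>R C"
      using signed[OF e] by blast
    have c1: "C'$2 = r * y" using 2 by (auto simp: C'(3) e_def)
    have c2: "\<bar>C'$1\<bar> \<le> r * x" using Cle by (auto simp: C'(3) e_def)
    have "\<exists>\<theta> \<phi> q. cell (swap ` L) \<theta> \<phi> (swap C'$1) q \<and> r * x \<le> q \<and> \<theta> < 1 \<and> \<phi> \<le> 1"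
    proof (rule cell_from_minimal_vector)
      show "swap ` L = lattice_span (swap C') (swap D')" by (simp add: C'(2) swap_lattice_span)
      show "\<bar>det (vector [swap C', swap D'] :: real^2^2)\<bar> = 1"
        using C'(1) by (simp add: det_vector2 abs_minus_commute)
      show "r * x \<le> \<bar>v$2\<bar>" if v: "v \<in> swap ` L" "v \<noteq> 0" "\<bar>v$1\<bar> < swap C' $ 1" for v
      proof -
        obtain w where w: "w \<in> L" "v = swap w" using v(1) by blast
        then show ?thesis using v(2,3) least[OF w(1)] c1 by auto
      qed
    qed (use c1 c2 rxy xy in auto)
    then obtain \<theta> \<phi> q where cell: "cell (swap ` L) \<theta> \<phi> (r * y) q" and b: "r * x \<le> q" "\<theta> < 1" "\<phi> \<le> 1"
      unfolding swap_nth c1 by blast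
    have "cell L \<phi> \<theta> q (r * y)" using cell_swap[OF cell] by simp
    then show ?thesis
      by (intro exI[of _ \<phi>] exI[of _ \<theta>] exI[of _ q] exI[of _ "r * y"]) (use b rxy in auto)
  qed
qed

lemma unimodular_has_cell:
  assumes "unimodular_lattice L"
  shows "\<exists>\<theta> \<phi> p q. cell L \<theta> \<phi> p q \<and> \<theta> \<le> 1 \<and> \<phi> \<le> 1"
  using admissible_inside_cell[OF assms] unimodular_has_admissible[OF assms] by blast

section \<open>Mordell constants from cells\<close>

lemma admissible_area_le_1:
  assumes "unimodular_lattice L" "admissible L x y"
  shows "x * y \<le> 1"
proof -
  obtain \<theta> \<phi> p q where c: "cell L \<theta> \<phi> p q" "x < p" "y < q"
    using admissible_inside_cell[OF assms] by blast
  have "x > 0" "y > 0" using assms(2) by (auto simp: admissible_def)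
  then have "x * y \<le> p * q" using c by (intro mult_mono) auto
  also have "p * q \<le> 1"
  proof -
    have "\<theta> * \<phi> \<ge> 0" using c(1) by (simp add: cell_def)
    then show ?thesis unfolding cell_area[OF c(1)] by simp
  qed
  finally show ?thesis .
qed

lemma admissible_area_le_mordell_constant:
  assumes "unimodular_lattice L" "admissible L x y"
  shows "x * y \<le> mordell_constant L"
  unfolding mordell_constant_def
proof (rule cSup_upper)
  show "bdd_above {x * y | x y. admissible L x y}"
    using admissible_area_le_1[OF assms(1)] by (auto intro!: bdd_aboveI[of _ 1])
qed (use assms in blast)

lemma mordell_constant_le:
  assumes "unimodular_lattice L" "\<And>x y. admissible L x y \<Longrightarrow> x * y \<le> b"
  shows "mordell_constant L \<le> b"
  unfolding mordell_constant_def using unimodular_has_admissible[OF assms(1)] assms(2)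
  by (intro cSup_least) auto

text \<open>
  The open box of a cell is exhausted by admissible boxes.
\<close>

lemma cell_le_mordell_constant:
  assumes c: "cell L \<theta> \<phi> p q"
  shows "1 / (1 + \<theta> * \<phi>) \<le> mordell_constant L"
proof -
  have pos: "p > 0" "q > 0" using c by (auto simp: cell_def)
  have "t * (p * q) \<le> mordell_constant L" if t: "0 < t" "t < 1" for t
  proof -
    have "sqrt t < 1" using t by simp
    then have "admissible L (sqrt t * p) (sqrt t * q)"
      using pos t by (intro cell_admissible[OF c]) auto
    from admissible_area_le_mordell_constant[OF cell_unimodular[OF c] this]
    have "(sqrt t * sqrt t) * (p * q) \<le> mordell_constant L" by (simp only: mult_ac)
    then show ?thesis using t by simp
  qed
  then have "p * q \<le> mordell_constant L"
    by (rule field_le_mult_one_interval)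
  then show ?thesis by (simp add: cell_area[OF c])
qed

text \<open>
  A set of parameter pairs that is stable under the continued fraction step and under reversal. A
  bound on \<open>\<theta>\<close> below 1 makes the widths \<open>p\<close> of successive cells shrink geometrically; \<open>3/4 = [0; 1, 3]\<close>
  exceeds every continued fraction with digits 1 and 2.
\<close>

definition closed_orbit :: "(real \<times> real) set \<Rightarrow> real \<Rightarrow> bool" where
  "closed_orbit S c \<longleftrightarrow> (\<forall>(\<theta>, \<phi>) \<in> S. 0 < \<theta> \<and> \<theta> \<le> 3/4 \<and> c \<le> \<theta> * \<phi> \<and> (\<phi>, \<theta>) \<in> S \<and>
     (\<exists>a::int \<ge> 1. of_int a \<le> 1 / \<theta> \<and> (1 / \<theta> - a, 1 / (a + \<phi>)) \<in> S))"

text \<open>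
  Walk along the cells until their width drops below \<open>x\<close>. If \<open>\<theta> p \<le> x < p\<close>, the lattice point
  \<open>(\<plusminus> \<theta> p, q)\<close> forces \<open>y < q\<close>, so that \<open>x y\<close> is below the quarter area \<open>p q\<close> of a cell in the orbit.
\<close>

lemma closed_orbit_forward_bound:
  assumes S: "closed_orbit S c" and c: "c \<ge> 0"
    and "cell L \<theta> \<phi> p q" "(\<theta>, \<phi>) \<in> S" "admissible L x y" "(3/4) ^ n * p \<le> x" "x < p"
  shows "x * y \<le> 1 / (1 + c)"
  using assms(3-)
proof (induction n arbitrary: \<theta> \<phi> p q)
  case 0
  then show ?case by simp
next
  case (Suc n)
  have pos: "p > 0" "q > 0" "\<phi> \<ge> 0" using Suc.prems(1) by (auto simp: cell_def)
  obtain a :: int where th: "0 < \<theta>" "\<theta> \<le> 3/4" "c \<le> \<theta> * \<phi>" and a: "a \<ge> 1" "of_int a \<le> 1 / \<theta>"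
    "(1 / \<theta> - a, 1 / (a + \<phi>)) \<in> S"
    using S Suc.prems(2) unfolding closed_orbit_def by blast
  have step: "cell L (1 / \<theta> - a) (1 / (a + \<phi>)) (\<theta> * p) (q * (a + \<phi>))"
    using Suc.prems(1) th(1) a(1,2) by (rule cell_step)
  show ?case
  proof (cases "\<theta> * p \<le> x")
    case True
    from cell_point_blocks[OF step Suc.prems(3) this] have "y < q" using a pos by simp
    moreover have "x > 0" using Suc.prems(3) by (simp add: admissible_def)
    ultimately have "x * y \<le> p * q" using Suc.prems(5) pos Suc.prems(3)
      by (intro mult_mono) (auto simp: admissible_def)
    also have "\<dots> = 1 / (1 + \<theta> * \<phi>)" using Suc.prems(1) by (rule cell_area)
    also have "\<dots> \<le> 1 / (1 + c)" using th c by (intro divide_left_mono) (auto intro: add_pos_nonneg)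
    finally show ?thesis .
  next
    case False
    have "(3/4) ^ n * (\<theta> * p) \<le> (3/4) ^ n * (3/4 * p)"
      using th pos by (intro mult_left_mono mult_right_mono) auto
    also have "\<dots> \<le> x" using Suc.prems(4) by (simp add: mult_ac)
    finally show ?thesis using Suc.IH[OF step a(3) Suc.prems(3)] False by simp
  qed
qed

text \<open>
  Boxes wider than the starting cell are flatter than it, so after exchanging the coordinates they
  are narrower than the reversed cell.
\<close>

lemma closed_orbit_bound:
  assumes S: "closed_orbit S c" and c: "c \<ge> 0"
    and cell: "cell L \<theta> \<phi> p q" "(\<theta>, \<phi>) \<in> S" and adm: "admissible L x y"
  shows "x * y \<le> 1 / (1 + c)"
proof -
  have forward: "x * y \<le> 1 / (1 + c)"
    if "cell L \<theta> \<phi> p q" "(\<theta>, \<phi>) \<in> S" "admissible L x y" "x < p" for L \<theta> \<phi> p q x y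
  proof -
    have pos: "p > 0" "x > 0" using that by (auto simp: cell_def admissible_def)
    then obtain n where "(3/4) ^ n < x / p"
      using real_arch_pow_inv[of "x / p" "3/4"] by auto
    then have "(3/4) ^ n * p \<le> x" using pos by (simp add: field_simps)
    then show ?thesis using closed_orbit_forward_bound[OF S c] that by blast
  qed
  show ?thesis
  proof (cases "x < p")
    case True
    then show ?thesis using forward cell adm by blast
  next
    case False
    have mem: "(\<phi>, \<theta>) \<in> S" "\<phi> \<le> 3/4" using S cell(2) unfolding closed_orbit_def by blast+
    have q: "q > 0" using cell(1) by (simp add: cell_def)
    have "y < \<phi> * q" using cell_point_blocks[OF cell(1) adm] False by simp
    also have "\<dots> \<le> 1 * q" using mem q by (intro mult_right_mono) auto
    finally have "y < q" by simp
    then have "y * x \<le> 1 / (1 + c)"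
      using forward cell_swap[OF cell(1)] mem(1) admissible_swap[OF cell_zero[OF cell(1)] adm] by blast
    then show ?thesis by (simp add: mult.commute)
  qed
qed

lemma mordell_constant_closed_orbit:
  assumes S: "closed_orbit S (\<theta> * \<phi>)" and cell: "cell L \<theta> \<phi> p q" "(\<theta>, \<phi>) \<in> S"
  shows "mordell_constant L = 1 / (1 + \<theta> * \<phi>)"
proof (rule antisym)
  have "\<theta> * \<phi> \<ge> 0" using cell(1) by (simp add: cell_def)
  then show "mordell_constant L \<le> 1 / (1 + \<theta> * \<phi>)"
    using mordell_constant_le[OF cell_unimodular[OF cell(1)]] closed_orbit_bound[OF S _ cell] by blast
qed (rule cell_le_mordell_constant[OF cell(1)])

section \<open>The golden ratio and runs of ones\<close>

text \<open>
  The number \<open>[0; 1, 1, 1, \<dots>]\<close>, the reciprocal of the golden ratio.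
\<close>

definition golden :: real where
  "golden = (sqrt 5 - 1) / 2"

lemma golden_bounds: "618/1000 < golden" "golden < 619/1000"
proof -
  have "2236/1000 < sqrt 5" by (rule real_less_rsqrt) (simp add: power2_eq_square)
  then show "618/1000 < golden" by (simp add: golden_def)
  have "sqrt 5 < 2238/1000" by (rule real_less_lsqrt) (simp_all add: power2_eq_square)
  then show "golden < 619/1000" by (simp add: golden_def)
qed

lemma golden_sq: "golden * golden = 1 - golden"
  by (simp add: golden_def field_simps)

lemma golden_fixed: "1 / (1 + golden) = golden"
  using golden_sq golden_bounds by (simp add: field_simps)

text \<open>
  The continued fraction \<open>[0; 1, \<dots>, 1 + x]\<close> with \<open>n\<close> digits 1.
\<close>

definition ones :: "nat \<Rightarrow> real \<Rightarrow> real" where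
  "ones n = (\<lambda>x. 1 / (1 + x)) ^^ n"

lemma ones_0 [simp]: "ones 0 x = x"
  by (simp add: ones_def)

lemma ones_Suc: "ones (Suc n) x = 1 / (1 + ones n x)"
  by (simp add: ones_def)

lemma ones_Suc_inner: "ones (Suc n) x = ones n (1 / (1 + x))"
  by (induction n) (simp_all add: ones_Suc)

lemma ones_pos: "x > 0 \<Longrightarrow> ones n x > 0"
  by (induction n) (auto simp: ones_Suc intro: add_pos_pos)

lemma ones_bounds:
  assumes "1/3 \<le> x" "x \<le> 1/2"
  shows "1/3 \<le> ones n x \<and> ones n x \<le> 3/4"
proof (induction n)
  case (Suc n)
  then show ?case by (auto simp: ones_Suc field_simps)
qed (use assms in auto)

lemma ones_Suc_ge:
  assumes "1/3 \<le> x" "x \<le> 1/2"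
  shows "4/7 \<le> ones (Suc n) x"
  using ones_bounds[OF assms, of n] by (auto simp: ones_Suc field_simps)

lemma ones_fib:
  assumes "x > 0"
  shows "ones (Suc n) x = (real (fib (n + 1)) + real (fib n) * x) / (real (fib (n + 2)) + real (fib (n + 1)) * x)"
proof (induction n)
  case (Suc n)
  have pos: "real (fib (n + 2)) + real (fib (n + 1)) * x > 0"
    using assms fib_neq_0_nat[of "n + 2"] by (intro add_pos_nonneg) (auto simp del: fib.simps)
  have "ones (Suc (Suc n)) x = 1 / (1 + (real (fib (n + 1)) + real (fib n) * x) / (real (fib (n + 2)) + real (fib (n + 1)) * x))"
    by (simp only: ones_Suc[of "Suc n"] Suc)
  also have "\<dots> = (real (fib (n + 2)) + real (fib (n + 1)) * x) /
     ((real (fib (n + 2)) + real (fib (n + 1)) * x) + (real (fib (n + 1)) + real (fib n) * x))"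
  proof -
    have "1 / (1 + a / b) = b / (b + a)" if "b > 0" for a b :: real
      using that by (simp add: field_simps)
    from this[OF pos] show ?thesis .
  qed
  finally show ?case by (simp add: algebra_simps)
qed (use assms in \<open>simp add: ones_Suc\<close>)

text \<open>
  The value of \<open>[0; 1, \<dots>, 1, 2, 1, \<dots>, 1, 2, \<dots>]\<close> in which all runs of ones have length \<open>2 t - 1\<close>;
  the closed form comes from the quadratic equation behind \<open>periodic_tail_fixed\<close>.
\<close>

definition periodic_tail :: "nat \<Rightarrow> real" where
  "periodic_tail t = sqrt (real (fib (2 * t + 2)) / real (fib (2 * t))) - 1"

lemma periodic_tail_bounds: "0 \<le> periodic_tail (Suc k)" "periodic_tail (Suc k) \<le> 1"
proof -
  define a b where "a = real (fib (2 * Suc k))" and "b = real (fib (2 * Suc k + 2))"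
  have a: "a > 0" by (simp add: a_def fib_neq_0_nat del: fib.simps)
  have "fib (2 * Suc k) \<le> fib (2 * Suc k + 2)" by (intro fib_mono) auto
  then have "a \<le> b" unfolding a_def b_def by linarith
  then have "1 \<le> sqrt (b / a)" using a by simp
  then show "0 \<le> periodic_tail (Suc k)" unfolding periodic_tail_def a_def b_def by linarith
  have "fib (2 * Suc k + 2) \<le> 4 * fib (2 * Suc k)" by simp
  then have "b \<le> 4 * a" unfolding a_def b_def by linarith
  then have "b / a \<le> 2\<^sup>2" using a by (simp add: divide_le_eq)
  then have "sqrt (b / a) \<le> 2" by (intro real_le_lsqrt) auto
  then show "periodic_tail (Suc k) \<le> 1" unfolding periodic_tail_def a_def b_def by linarith
qed

text \<open>
  By \<open>ones_fib\<close> the fixed points \<open>x\<close> of this map satisfy \<open>(x + 1)\<^sup>2 F = F'\<close>, where \<open>F\<close> and \<open>F'\<close> are the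
  Fibonacci numbers with indices \<open>2 k + 2\<close> and \<open>2 k + 4\<close>.
\<close>

lemma periodic_tail_fixed: "ones (2 * k + 1) (1 / (2 + periodic_tail (Suc k))) = periodic_tail (Suc k)"
proof -
  define x where "x = periodic_tail (Suc k)"
  define a b where "a = real (fib (2 * k))" and "b = real (fib (2 * k + 1))"
  have ab: "a \<ge> 0" "b > 0" by (auto simp: a_def b_def fib_neq_0_nat)
  have f2: "real (fib (2 * k + 2)) = a + b" by (simp add: a_def b_def)
  have f4: "real (fib (2 * k + 4)) = 2 * a + 3 * b" by (simp add: a_def b_def numeral_eq_Suc)
  have x: "x \<ge> 0" unfolding x_def by (rule periodic_tail_bounds)
  have "x + 1 = sqrt ((2 * a + 3 * b) / (a + b))"
    using f2 f4 by (simp add: x_def periodic_tail_def numeral_eq_Suc add.commute)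
  then have "(x + 1)\<^sup>2 = (2 * a + 3 * b) / (a + b)" using ab by simp
  then have quad: "(x + 1) * (x + 1) * (a + b) = 2 * a + 3 * b"
    using ab by (simp add: power2_eq_square field_simps)
  have "ones (2 * k + 1) (1 / (2 + x)) = (b + a * (1 / (2 + x))) / ((a + b) + b * (1 / (2 + x)))"
    using ones_fib[of "1 / (2 + x)" "2 * k"] x by (simp add: f2[simplified] a_def b_def)
  also have "\<dots> = (b * (2 + x) + a) / ((a + b) * (2 + x) + b)"
    using x ab by (simp add: divide_simps)
  also have "\<dots> = x"
  proof -
    have "(a + b) * (2 + x) + b > 0" using x ab by (intro add_nonneg_pos) auto
    moreover have "b * (2 + x) + a = x * ((a + b) * (2 + x) + b)"
      using quad by (simp add: algebra_simps)
    ultimately show ?thesis by (simp add: divide_eq_eq)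
  qed
  finally show ?thesis by (simp add: x_def)
qed

lemma periodic_tail_value:
  "1 / (1 + 1 / (2 + periodic_tail (Suc k)) * periodic_tail (Suc k)) =
    (1 + sqrt (real (fib (2 * Suc k)) / real (fib (2 * Suc k + 2)))) / 2"
proof -
  define x where "x = periodic_tail (Suc k)"
  have x: "x \<ge> 0" unfolding x_def by (rule periodic_tail_bounds)
  have "sqrt (real (fib (2 * Suc k)) / real (fib (2 * Suc k + 2))) = 1 / (1 + x)"
    unfolding x_def periodic_tail_def by (simp add: real_sqrt_divide)
  moreover have "1 / (1 + 1 / (2 + x) * x) = (1 + 1 / (1 + x)) / 2"
    using x by (simp add: field_simps)
  ultimately show ?thesis by (simp add: x_def)
qed

section \<open>The extremal lattices\<close>

lemma closed_orbit_golden: "closed_orbit {(golden, golden)} (golden * golden)"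
proof -
  have "1 \<le> 1 / golden" "1 / golden - 1 = golden"
    using golden_bounds golden_sq by (auto simp: field_simps)
  then show ?thesis using golden_bounds golden_fixed
    unfolding closed_orbit_def by (auto intro!: exI[of _ 1])
qed

text \<open>
  Cutting the periodic expansion inside a run of \<open>2 k + 1\<close> ones leaves \<open>i\<close> of them on one side and \<open>j\<close>
  on the other. The product is smallest for a cut next to a digit 2, because at every other cut both
  halves are at least \<open>4/7\<close>.
\<close>

lemma closed_orbit_periodic:
  fixes k
  defines "u \<equiv> 1 / (2 + periodic_tail (Suc k))"
  shows "closed_orbit {(ones i u, ones j u) | i j. i + j = 2 * k + 1} (u * periodic_tail (Suc k))"
    (is "closed_orbit ?S _")
proof -
  define x where "x = periodic_tail (Suc k)"
  have x01: "0 \<le> x" "x \<le> 1" unfolding x_def by (rule periodic_tail_bounds)+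
  have ux: "u = 1 / (2 + x)" by (simp add: u_def x_def)
  have u: "1/3 \<le> u" "u \<le> 1/2" using x01 by (auto simp: ux field_simps)
  have fix_x: "ones (2 * k + 1) u = x" unfolding u_def x_def by (rule periodic_tail_fixed)
  have x34: "x \<le> 3/4" using ones_bounds[OF u, of "2 * k + 1"] fix_x by simp
  have prod: "u * x \<le> 16/49" using x34 x01 by (simp add: ux field_simps)
  have main: "0 < ones i u \<and> ones i u \<le> 3/4 \<and> u * x \<le> ones i u * ones j u \<and>
      (ones j u, ones i u) \<in> ?S \<and>
      (\<exists>a::int \<ge> 1. of_int a \<le> 1 / ones i u \<and> (1 / ones i u - a, 1 / (a + ones j u)) \<in> ?S)"
    if ij: "i + j = 2 * k + 1" for i j
  proof (intro conjI)
    show "0 < ones i u" "ones i u \<le> 3/4" using ones_bounds[OF u, of i] by auto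
    show "(ones j u, ones i u) \<in> ?S" using ij by (intro CollectI exI[of _ j] exI[of _ i]) auto
    show "u * x \<le> ones i u * ones j u"
    proof (cases "i = 0 \<or> j = 0")
      case True
      then show ?thesis using ij fix_x by auto
    next
      case False
      then have "4/7 \<le> ones i u" "4/7 \<le> ones j u"
        using ones_Suc_ge[OF u, of "i - 1"] ones_Suc_ge[OF u, of "j - 1"] by auto
      then have "4/7 * (4/7) \<le> ones i u * ones j u" by (intro mult_mono) auto
      then show ?thesis using prod by simp
    qed
    show "\<exists>a::int \<ge> 1. of_int a \<le> 1 / ones i u \<and> (1 / ones i u - a, 1 / (a + ones j u)) \<in> ?S"
    proof (cases i)
      case 0
      then have j: "ones j u = x" using ij fix_x by simp
      have "1 / ones i u - 2 = ones (2 * k + 1) u" "1 / (2 + ones j u) = ones 0 u"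
        using 0 x01 j fix_x by (auto simp: ux)
      moreover have "2 \<le> 1 / ones i u" using 0 x01 by (simp add: ux)
      ultimately show ?thesis
        by (intro exI[of _ 2] conjI CollectI exI[of _ "2 * k + 1"] exI[of _ 0]) auto
    next
      case (Suc i')
      have "ones i' u \<ge> 1/3" using ones_bounds[OF u, of i'] by simp
      then have "1 / ones i u - 1 = ones i' u" "1 / (1 + ones j u) = ones (Suc j) u" "1 \<le> 1 / ones i u"
        by (auto simp: Suc ones_Suc)
      then show ?thesis using ij Suc
        by (intro exI[of _ 1] conjI CollectI exI[of _ i'] exI[of _ "Suc j"]) auto
    qed
  qed
  show ?thesis unfolding closed_orbit_def x_def[symmetric] using main by blast
qed

text \<open>
  The bi-infinite expansion with a single digit 2 among ones. A cut has only ones on one side, and \<open>i\<close>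
  ones followed by the 2 on the other.
\<close>

lemma closed_orbit_single_two:
  fixes u
  defines "u \<equiv> 1 / (2 + golden)"
  shows "closed_orbit (range (\<lambda>i. (golden, ones i u)) \<union> range (\<lambda>i. (ones i u, golden))) (u * golden)"
    (is "closed_orbit ?S _")
proof -
  have g: "golden > 0" "golden \<le> 3/4" using golden_bounds by auto
  have u: "1/3 \<le> u" "u \<le> 1/2" using golden_bounds by (auto simp: u_def field_simps)
  have low: "u \<le> ones i u" for i
  proof (cases i)
    case (Suc i')
    then show ?thesis using ones_Suc_ge[OF u, of i'] u by simp
  qed simp
  have u0: "0 < u" using u by simp
  have step1: "1 \<le> 1 / golden" "1 / golden - 1 = golden"
    using golden_bounds golden_sq by (auto simp: field_simps)
  have 1: "\<exists>a::int \<ge> 1. of_int a \<le> 1 / golden \<and> (1 / golden - a, 1 / (a + ones i u)) \<in> ?S" for i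
    using step1 by (intro exI[of _ 1]) (auto simp: ones_Suc[symmetric])
  have 2: "\<exists>a::int \<ge> 1. of_int a \<le> 1 / ones i u \<and> (1 / ones i u - a, 1 / (a + golden)) \<in> ?S" for i
  proof (cases i)
    case 0
    have "(1 / u - 2, 1 / (2 + golden)) = (golden, ones 0 u)" "2 \<le> 1 / u" using g by (auto simp: u_def)
    moreover have "(golden, ones 0 u) \<in> ?S" by blast
    ultimately show ?thesis using 0 by (intro exI[of _ 2]) simp
  next
    case (Suc i')
    have "ones i' u \<ge> 1/3" using ones_bounds[OF u, of i'] by simp
    then have "(1 / ones i u - 1, 1 / (1 + golden)) = (ones i' u, golden)" "1 \<le> 1 / ones i u"
      using golden_fixed by (auto simp: Suc ones_Suc)
    then show ?thesis by (intro exI[of _ 1]) auto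
  qed
  show ?thesis
    unfolding closed_orbit_def using 1 2 g u0 low ones_bounds[OF u]
    by (auto simp: mult.commute[of _ golden] ones_pos intro!: mult_left_mono less_le_trans[OF _ low] dest: spec)
qed

section \<open>Orbits of small Mordell constant\<close>

lemma ones_golden_contract:
  assumes "x > 0"
  shows "\<bar>ones n x - golden\<bar> \<le> golden ^ n * \<bar>x - golden\<bar>"
proof (induction n)
  case (Suc n)
  have pos: "ones n x > 0" using assms by (rule ones_pos)
  have "ones (Suc n) x - golden = 1 / (1 + ones n x) - 1 / (1 + golden)"
    by (simp add: ones_Suc golden_fixed)
  also have "\<dots> = (golden - ones n x) / (1 + ones n x) * (1 / (1 + golden))"
    using pos golden_bounds by (simp add: field_simps)
  also have "\<dots> = (golden - ones n x) / (1 + ones n x) * golden"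
    by (simp only: golden_fixed)
  finally have "\<bar>ones (Suc n) x - golden\<bar> = \<bar>ones n x - golden\<bar> / (1 + ones n x) * golden"
    using pos golden_bounds by (simp add: abs_mult abs_minus_commute)
  also have "\<dots> \<le> \<bar>ones n x - golden\<bar> * golden"
  proof (rule mult_right_mono)
    have "\<bar>ones n x - golden\<bar> * 1 \<le> \<bar>ones n x - golden\<bar> * (1 + ones n x)"
      using pos by (intro mult_left_mono) auto
    then show "\<bar>ones n x - golden\<bar> / (1 + ones n x) \<le> \<bar>ones n x - golden\<bar>"
      using pos by (simp add: divide_le_eq)
  qed (use golden_bounds in simp)
  also have "\<dots> \<le> golden ^ n * \<bar>x - golden\<bar> * golden"
    using Suc golden_bounds by (intro mult_right_mono) auto
  finally show ?case by (simp add: mult_ac)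
qed simp

lemma ones_side_golden:
  assumes "0 < x" "x < golden"
  shows "(even n \<longrightarrow> ones n x < golden) \<and> (odd n \<longrightarrow> golden < ones n x)"
proof (induction n)
  case (Suc n)
  have pos: "ones n x > 0" using assms by (intro ones_pos)
  have "1 / (1 + ones n x) < 1 / (1 + golden) \<longleftrightarrow> golden < ones n x"
    "1 / (1 + golden) < 1 / (1 + ones n x) \<longleftrightarrow> ones n x < golden"
    using pos golden_bounds by (auto simp: field_simps)
  then show ?case using Suc by (auto simp: ones_Suc golden_fixed)
qed (use assms in auto)

lemma ones_lipschitz:
  assumes "x > 0" "y > 0"
  shows "\<bar>ones n x - ones n y\<bar> \<le> \<bar>x - y\<bar>"
proof (induction n)
  case (Suc n)
  define a b where "a = ones n x" and "b = ones n y"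
  have pos: "a > 0" "b > 0" using assms by (auto simp: a_def b_def ones_pos)
  have "ones (Suc n) x - ones (Suc n) y = (b - a) / ((1 + a) * (1 + b))"
    using pos by (simp add: ones_Suc a_def[symmetric] b_def[symmetric] field_simps)
  then have "\<bar>ones (Suc n) x - ones (Suc n) y\<bar> = \<bar>a - b\<bar> / ((1 + a) * (1 + b))"
    using pos by (simp add: abs_minus_commute)
  also have "\<dots> \<le> \<bar>a - b\<bar> / 1"
  proof (rule divide_left_mono)
    have "1 * 1 \<le> (1 + a) * (1 + b)" using pos by (intro mult_mono) auto
    then show "1 \<le> (1 + a) * (1 + b)" by simp
  qed (use pos in auto)
  also have "\<dots> \<le> \<bar>x - y\<bar>" using Suc by (simp add: a_def b_def)
  finally show ?case .
qed simp

text \<open>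
  The coordinate in which \<open>x \<mapsto> 1 / (1 + x)\<close> is linear: it sends the two fixed points \<open>golden\<close> and
  \<open>- 1 - golden\<close> to 0 and infinity.
\<close>

definition golden_coord :: "real \<Rightarrow> real" where
  "golden_coord x = (x - golden) / (x + 1 + golden)"

lemma golden_coord_step:
  assumes "x > 0"
  shows "golden_coord (1 / (1 + x)) = - (golden * golden) * golden_coord x"
proof -
  have pos: "1 + x > 0" "x + 1 + golden > 0" using assms golden_bounds by auto
  have num: "1 / (1 + x) - golden = - golden * (x - golden) / (1 + x)"
  proof -
    have "1 - golden * (1 + x) = - golden * (x - golden)"
      using golden_sq by (simp add: algebra_simps)
    moreover have "1 / (1 + x) - golden = (1 - golden * (1 + x)) / (1 + x)"
      using pos by (simp add: diff_divide_distrib)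
    ultimately show ?thesis by (simp only:)
  qed
  have den: "1 / (1 + x) + 1 + golden = (1 + golden) * (x + 1 + golden) / (1 + x)"
  proof -
    have "1 + (1 + golden) * (1 + x) = (1 + golden) * (x + 1 + golden)"
      using golden_sq by (simp add: algebra_simps)
    moreover have "1 / (1 + x) + 1 + golden = (1 + (1 + golden) * (1 + x)) / (1 + x)"
      using pos by (simp add: add_divide_distrib)
    ultimately show ?thesis by (simp only:)
  qed
  have "golden_coord (1 / (1 + x)) = - golden * (x - golden) / ((1 + golden) * (x + 1 + golden))"
    unfolding golden_coord_def num den using pos by simp
  also have "\<dots> = - golden * (1 / (1 + golden)) * golden_coord x"
    by (simp add: golden_coord_def)
  finally show ?thesis by (simp only: golden_fixed) simp
qed

lemma golden_coord_ones:
  assumes "x > 0"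
  shows "golden_coord (ones n x) = (- (golden * golden)) ^ n * golden_coord x"
proof (induction n)
  case (Suc n)
  then show ?case
    using golden_coord_step[OF ones_pos[OF assms], of n] by (simp add: ones_Suc)
qed simp

text \<open>
  The smaller of \<open>y\<close> and \<open>z\<close>, say \<open>x\<close>, satisfies \<open>(2 golden - 1) (2 + x) < x\<close>. At \<open>x = golden\<close> this
  is an equality, which is why \<open>golden\<close> is the threshold for the neighbours of a digit 2.
\<close>

lemma both_above_golden:
  assumes "(2 * golden - 1) * (2 + z) < y" "(2 * golden - 1) * (2 + y) < z"
  shows "golden < y" "golden < z"
proof -
  have key: "golden < x" if "(2 * golden - 1) * (2 + x) < x" for x
  proof -
    have "(2 * golden - 1) * 2 < x * (2 - 2 * golden)" using that by (simp add: algebra_simps)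
    then have "golden * (1 - golden) < x * (1 - golden)" using golden_sq by (simp add: algebra_simps)
    then show ?thesis using golden_bounds by (simp add: mult_less_cancel_right)
  qed
  have c: "0 \<le> 2 * golden - 1" using golden_bounds by simp
  have "golden < y \<and> golden < z"
  proof (cases "y \<le> z")
    case True
    then have "(2 * golden - 1) * (2 + y) \<le> (2 * golden - 1) * (2 + z)"
      using c by (intro mult_left_mono) auto
    then show ?thesis using key[of y] assms True by linarith
  next
    case False
    then have "(2 * golden - 1) * (2 + z) \<le> (2 * golden - 1) * (2 + y)"
      using c by (intro mult_left_mono) auto
    then show ?thesis using key[of z] assms False by linarith
  qed
  then show "golden < y" "golden < z" by auto
qed

text \<open>
  Here \<open>y\<close> and \<open>z\<close> are the tails on the two sides of a digit 2, beginning with \<open>2 s + 1\<close> and \<open>2 t + 1\<close>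
  ones that are followed by another 2. A longer run brings a tail closer to \<open>golden\<close>: in the linear
  coordinate each additional pair of ones costs a factor \<open>golden ^ 4\<close>, less than \<open>0.146\<close>. The
  inequality between \<open>y\<close> and \<open>z\<close>, on the other hand, allows \<open>z\<close> to be closer to \<open>golden\<close> than \<open>y\<close> only
  by a factor of \<open>2 golden - 1\<close>, more than \<open>0.236\<close>. The digits beyond the two runs contribute another
  factor, at most \<open>1.56\<close>, which does not bridge this gap.
\<close>

lemma longer_run_impossible:
  assumes v: "golden < v" "v < 1" and w: "golden < w" "w < 1"
    and y: "y = ones (2 * s + 1) (1 / (2 + v))" and z: "z = ones (2 * t + 1) (1 / (2 + w))"
    and c: "(2 * golden - 1) * (2 + y) < z"
  shows "t \<le> s"
proof (rule ccontr)
  assume "\<not> t \<le> s"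
  then obtain d where d: "t = s + 1 + d" by (metis add.commute add_Suc_right less_imp_Suc_add not_le plus_1_eq_Suc)
  note gb = golden_bounds
  define R where "R = golden_coord"
  \<comment> \<open>The factor common to the coordinates of \<open>y\<close> and \<open>z\<close>.\<close>
  define K where "K = (golden * golden) ^ (2 * s + 1)"
  have K: "K > 0" using gb by (simp add: K_def)
  define a b where "a = - R (1 / (2 + w))" and "b = - R (1 / (2 + v))"
  have neg_coord: "- R (1 / (2 + x)) = (golden * (2 + x) - 1) / (1 + (1 + golden) * (2 + x))" if "x > 0" for x
  proof -
    have "1 / (2 + x) - golden = (1 - golden * (2 + x)) / (2 + x)"
      "1 / (2 + x) + 1 + golden = (1 + (1 + golden) * (2 + x)) / (2 + x)"
      using that by (simp_all add: diff_divide_distrib add_divide_distrib)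
    then have "R (1 / (2 + x)) = (1 - golden * (2 + x)) / (1 + (1 + golden) * (2 + x))"
      unfolding R_def golden_coord_def using that by simp
    then show ?thesis by (simp only: minus_divide_left minus_diff_eq)
  qed
  have g_prod: "golden * (2 + golden) = 1 + golden" "(1 + golden) * (2 + golden) = 3 + 2 * golden"
    using golden_sq by (auto simp: algebra_simps)
  \<comment> \<open>Both tails at the far ends of the runs are of the form \<open>1 / (2 + x)\<close> with \<open>golden < x < 1\<close>, which
    confines their coordinates to a narrow range.\<close>
  have a: "0 \<le> a" "a \<le> 857/5236"
  proof -
    have "golden * (2 + golden) \<le> golden * (2 + w)" using w gb by (intro mult_left_mono) auto
    then have N: "0 \<le> golden * (2 + w) - 1" using gb g_prod by linarith
    have "golden * (2 + w) \<le> golden * 3" using w gb by (intro mult_left_mono) auto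
    moreover have "golden * 3 - 1 \<le> 857/1000" using gb by simp
    ultimately have N': "golden * (2 + w) - 1 \<le> 857/1000" by linarith
    have "(1 + golden) * (2 + golden) \<le> (1 + golden) * (2 + w)" using w gb by (intro mult_left_mono) auto
    then have D: "5236/1000 \<le> 1 + (1 + golden) * (2 + w)" using g_prod gb by linarith
    have eq: "a = (golden * (2 + w) - 1) / (1 + (1 + golden) * (2 + w))"
      unfolding a_def using w gb by (intro neg_coord) simp
    show "0 \<le> a" unfolding eq using N D by (intro divide_nonneg_nonneg) linarith+
    have "a \<le> 857/1000 / (5236/1000)" unfolding eq using N N' D by (intro frac_le) linarith+
    then show "a \<le> 857/5236" by simp
  qed
  have b: "618/5857 \<le> b"
  proof -
    have "golden * (2 + golden) \<le> golden * (2 + v)" using v gb by (intro mult_left_mono) auto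
    then have N: "618/1000 \<le> golden * (2 + v) - 1" using gb g_prod by linarith
    have "(1 + golden) * (2 + v) \<le> (1 + golden) * 3" using v gb by (intro mult_left_mono) auto
    then have D: "1 + (1 + golden) * (2 + v) \<le> 5857/1000" using gb by simp
    have "(1 + golden) * (2 + v) > 0" using v gb by (intro mult_pos_pos) auto
    then have D': "0 < 1 + (1 + golden) * (2 + v)" by simp
    have eq: "b = (golden * (2 + v) - 1) / (1 + (1 + golden) * (2 + v))"
      unfolding b_def using v gb by (intro neg_coord) simp
    have "618/1000 / (5857/1000) \<le> b" unfolding eq using N D D' by (intro frac_le) linarith+
    then show ?thesis by simp
  qed
  have Ry: "R y = K * b"
    using golden_coord_ones[of "1 / (2 + v)" "2 * s + 1"] v gb
    by (simp add: y R_def K_def b_def power_minus_odd)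
  have Rz: "R z = K * ((golden * golden) ^ 2 * (golden * golden) ^ (2 * d) * a)"
  proof -
    have "R z = (golden * golden) ^ (2 * t + 1) * a"
      using golden_coord_ones[of "1 / (2 + w)" "2 * t + 1"] w gb
      by (simp add: z R_def a_def power_minus_odd)
    also have "2 * t + 1 = (2 * s + 1) + (2 + 2 * d)" using d by simp
    finally show ?thesis unfolding K_def power_add by (simp only: mult.assoc)
  qed
  have upper: "R z \<le> K * ((382/1000)\<^sup>2 * 1 * (857/5236))"
  proof -
    have g2: "0 \<le> golden * golden" "golden * golden \<le> 382/1000" "golden * golden \<le> 1"
      using golden_sq gb by auto
    have "(golden * golden) ^ (2 * d) \<le> 1" using g2 by (intro power_le_one) auto
    moreover have "(golden * golden)\<^sup>2 \<le> (382/1000)\<^sup>2" using g2 by (intro power_mono) auto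
    ultimately show ?thesis unfolding Rz using K a g2
      by (intro mult_left_mono mult_mono) auto
  qed
  have pos: "y > 0" "z > 0" unfolding y z using v w gb by (auto intro!: ones_pos)
  have "R y > 0" unfolding Ry using K b by (intro mult_pos_pos) auto
  then have yg: "y > golden" using pos gb by (simp add: R_def golden_coord_def zero_less_divide_iff)
  have zy: "(2 * golden - 1) * (y - golden) < z - golden"
  proof -
    have "(2 * golden - 1) * (2 + golden) = golden" using golden_sq by (simp add: algebra_simps)
    then show ?thesis using c by (simp add: algebra_simps)
  qed
  have "236/1000 * (y - golden) \<le> (2 * golden - 1) * (y - golden)"
    using yg gb by (intro mult_right_mono) auto
  then have zy': "236/1000 * (y - golden) \<le> z - golden" using zy by linarith
  then have zg: "z > golden" using yg by simp
  have lower: "236/1000 * R y \<le> R z"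
  proof (cases "z \<le> y")
    case True
    have "236/1000 * R y = ((236/1000) * (y - golden)) / (y + 1 + golden)"
      by (simp add: R_def golden_coord_def)
    also have "\<dots> \<le> (z - golden) / (z + 1 + golden)"
      using zy' True zg yg gb pos by (intro frac_le) auto
    finally show ?thesis by (simp add: R_def golden_coord_def)
  next
    case False
    have "R y = 1 - (1 + 2 * golden) / (y + 1 + golden)" "R z = 1 - (1 + 2 * golden) / (z + 1 + golden)"
      using pos gb by (auto simp: R_def golden_coord_def field_simps)
    moreover have "(1 + 2 * golden) / (z + 1 + golden) \<le> (1 + 2 * golden) / (y + 1 + golden)"
      using False pos gb by (intro divide_left_mono) auto
    ultimately show ?thesis using \<open>R y > 0\<close> by linarith
  qed
  have "K * ((236/1000) * (618/5857)) \<le> 236/1000 * R y"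
    unfolding Ry using K b by simp
  then have "K * ((236/1000) * (618/5857)) \<le> K * ((382/1000)\<^sup>2 * 1 * (857/5236))"
    using lower upper by linarith
  then have "236/1000 * (618/5857) \<le> ((382/1000)\<^sup>2 * 1 * (857/5236) :: real)"
    using K by (simp only: mult_le_cancel_left_pos)
  then show False by (simp add: power2_eq_square)
qed

text \<open>
  The forward half of the behaviour of the cells of a lattice with Mordell constant below
  \<open>(1 + sqrt 5) / 4\<close>. Since \<open>z\<close> lies strictly between 0 and 1 by membership in \<open>C\<close>, the number \<open>a\<close> is
  the leading continued fraction digit of \<open>\<theta>\<close>.
\<close>

definition gauss_closed :: "(real \<times> real) set \<Rightarrow> bool" where
  "gauss_closed C \<longleftrightarrow> (\<forall>(\<theta>, \<phi>) \<in> C. 0 < \<theta> \<and> \<theta> < 1 \<and> 0 < \<phi> \<and> \<phi> < 1 \<and> 2 * golden - 1 < \<theta> * \<phi> \<and>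
     (\<exists>a::int \<ge> 1. \<exists>z. \<theta> = 1 / (of_int a + z) \<and> (z, 1 / (of_int a + \<phi>)) \<in> C))"

lemma gauss_closedD:
  fixes \<theta> \<phi> :: real
  assumes "gauss_closed C" "(\<theta>, \<phi>) \<in> C"
  shows "0 < \<theta>" "\<theta> < 1" "0 < \<phi>" "\<phi> < 1" "2 * golden - 1 < \<theta> * \<phi>"
    "\<exists>a::int \<ge> 1. \<exists>z. \<theta> = 1 / (of_int a + z) \<and> (z, 1 / (of_int a + \<phi>)) \<in> C"
  using assms unfolding gauss_closed_def by blast+

text \<open>
  The products at the cuts on both sides of a digit \<open>a \<ge> 3\<close> can exceed the threshold only if both
  adjacent tails are above \<open>9/10\<close>. Then \<open>z = 1 / (1 + w)\<close> with \<open>w < 1/9\<close>, and the cut in front of \<open>w\<close>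
  has too small a product.
\<close>

lemma digit_1_or_2:
  assumes C: "gauss_closed C" and mem: "(\<theta>, \<phi>) \<in> C"
  obtains z where "\<theta> = 1 / (1 + z)" "(z, 1 / (1 + \<phi>)) \<in> C"
  | z where "\<theta> = 1 / (2 + z)" "(z, 1 / (2 + \<phi>)) \<in> C"
proof -
  obtain a :: int and z :: real where a: "a \<ge> 1" "\<theta> = 1 / (of_int a + z)" and z: "(z, 1 / (of_int a + \<phi>)) \<in> C"
    using gauss_closedD(6)[OF C mem] by blast
  have "a \<le> 2"
  proof (rule ccontr)
    assume "\<not> a \<le> 2"
    then have a3: "3 \<le> real_of_int a" by simp
    note p = gauss_closedD(3-5)[OF C mem] and q = gauss_closedD(1,2,5)[OF C z]
    have 1: "236 * (a + z) < 1000 * \<phi>" and 2: "236 * (a + \<phi>) < 1000 * z"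
    proof -
      have pos: "a + z > 0" "a + \<phi> > 0" using a3 p q by auto
      have "2 * golden - 1 < \<phi> / (a + z)" "2 * golden - 1 < z / (a + \<phi>)" using p q a(2) by auto
      moreover have "236/1000 < 2 * golden - 1" using golden_bounds by simp
      ultimately have "236/1000 < \<phi> / (a + z)" "236/1000 < z / (a + \<phi>)" by (blast intro: less_trans)+
      then show "236 * (a + z) < 1000 * \<phi>" "236 * (a + \<phi>) < 1000 * z"
        using pos by (simp_all add: less_divide_eq field_simps)
    qed
    have "\<phi> > 7/10" using 1 a3 q(1) by (simp add: distrib_left)
    then have "z > 85/100" using 2 a3 by (simp add: distrib_left)
    then have "\<phi> > 9/10" using 1 a3 by (simp add: distrib_left)
    then have z9: "z > 9/10" using 2 a3 by (simp add: distrib_left)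
    obtain b :: int and w :: real where b: "b \<ge> 1" "z = 1 / (of_int b + w)" and w: "(w, 1 / (of_int b + 1 / (of_int a + \<phi>))) \<in> C"
      using gauss_closedD(6)[OF C z] by blast
    note r = gauss_closedD(1,3,4,5)[OF C w]
    have "b + w < 1 / (9/10)" using z9 b r by (simp add: field_simps)
    moreover have "real_of_int b \<ge> 1" using b(1) by simp
    ultimately have "w < 1/9" by simp
    then have "w * (1 / (b + 1 / (a + \<phi>))) \<le> 1/9 * 1" using r by (intro mult_mono) auto
    then show False using r golden_bounds by simp
  qed
  then have "a = 1 \<or> a = 2" using a(1) by auto
  then show thesis using that a(2) z by auto
qed

text \<open>
  A tail without any digit 2 would have distance at most \<open>golden ^ n\<close> from \<open>golden\<close> for every \<open>n\<close>.
\<close>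

lemma next_two:
  assumes C: "gauss_closed C" and mem: "(\<theta>, \<phi>) \<in> C" and neq: "\<theta> \<noteq> golden"
  shows "\<exists>n z. \<theta> = ones n (1 / (2 + z)) \<and> (1 / (2 + z), ones n \<phi>) \<in> C \<and> (z, 1 / (2 + ones n \<phi>)) \<in> C"
proof (rule ccontr)
  assume none: "\<not> ?thesis"
  have orbit: "\<exists>w. \<theta> = ones n w \<and> (w, ones n \<phi>) \<in> C" for n
  proof (induction n)
    case 0
    then show ?case using mem by auto
  next
    case (Suc n)
    then obtain w where w: "\<theta> = ones n w" "(w, ones n \<phi>) \<in> C" by blast
    from C w(2) show ?case
    proof (cases rule: digit_1_or_2)
      case (1 z)
      then have "\<theta> = ones (Suc n) z \<and> (z, ones (Suc n) \<phi>) \<in> C"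
        using w by (simp only: ones_Suc_inner[of n z] ones_Suc[of n \<phi>])
      then show ?thesis by blast
    next
      case (2 z)
      then show ?thesis using none w by auto
    qed
  qed
  have bound: "\<bar>\<theta> - golden\<bar> \<le> golden ^ n" for n
  proof -
    obtain w where w: "\<theta> = ones n w" "(w, ones n \<phi>) \<in> C" using orbit by blast
    note b = gauss_closedD(1,2)[OF C w(2)]
    have "\<bar>w - golden\<bar> \<le> 1" using b golden_bounds by auto
    then have "golden ^ n * \<bar>w - golden\<bar> \<le> golden ^ n * 1"
      using golden_bounds by (intro mult_left_mono) auto
    then show ?thesis using ones_golden_contract[OF b(1), of n] w(1) by simp
  qed
  have "\<bar>\<theta> - golden\<bar> > 0" using neq by simp
  then obtain n where "golden ^ n < \<bar>\<theta> - golden\<bar>"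
    using real_arch_pow_inv[of "\<bar>\<theta> - golden\<bar>" golden] golden_bounds by auto
  then show False using bound[of n] by simp
qed

text \<open>
  The digit 2 with the tails \<open>y\<close> to its left and \<open>z\<close> to its right: both cuts next to it occur in \<open>C\<close>.
\<close>

definition around_two :: "(real \<times> real) set \<Rightarrow> real \<Rightarrow> real \<Rightarrow> bool" where
  "around_two C y z \<longleftrightarrow> (1 / (2 + z), y) \<in> C \<and> (z, 1 / (2 + y)) \<in> C"

lemma around_two_converse: "around_two (C\<inverse>) y z \<longleftrightarrow> around_two C z y"
  by (auto simp: around_two_def)

lemma around_twoD:
  assumes C: "gauss_closed C" and two: "around_two C y z"
  shows "(2 * golden - 1) * (2 + z) < y" "(2 * golden - 1) * (2 + y) < z"
    "golden < y" "y < 1" "golden < z" "z < 1"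
proof -
  have m: "(1 / (2 + z), y) \<in> C" "(z, 1 / (2 + y)) \<in> C" using two by (auto simp: around_two_def)
  note p = gauss_closedD(3-5)[OF C m(1)] and q = gauss_closedD(1,2,5)[OF C m(2)]
  show y: "(2 * golden - 1) * (2 + z) < y" and z: "(2 * golden - 1) * (2 + y) < z"
    using p q by (auto simp: less_divide_eq)
  show "golden < y" "golden < z" using both_above_golden[OF y z] by auto
  show "y < 1" "z < 1" using p q by auto
qed

text \<open>
  A tail above \<open>golden\<close> reaches its first digit 2, a value below \<open>golden\<close>, only after an odd number
  of order-reversing steps.
\<close>

lemma next_around_two:
  assumes C: "gauss_closed C" and two: "around_two C y z"
  obtains t v where "z = ones (2 * t + 1) (1 / (2 + v))" "around_two C (ones (2 * t + 1) (1 / (2 + y))) v"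
proof -
  note D = around_twoD[OF C two]
  have mem: "(z, 1 / (2 + y)) \<in> C" using two by (simp add: around_two_def)
  obtain n v where n: "z = ones n (1 / (2 + v))" "(1 / (2 + v), ones n (1 / (2 + y))) \<in> C"
    "(v, 1 / (2 + ones n (1 / (2 + y)))) \<in> C"
    using next_two[OF C mem] D(5) by blast
  have v: "0 < v" using gauss_closedD(1)[OF C n(3)] .
  then have "1 / (2 + v) \<le> 1/2" by (simp add: field_simps)
  then have "1 / (2 + v) < golden" using golden_bounds by simp
  then have "odd n" using ones_side_golden[of "1 / (2 + v)" n] v n(1) D(5) by auto
  then obtain t where "n = 2 * t + 1" by (rule oddE)
  then show thesis using that n by (auto simp: around_two_def)
qed

lemma inverse_2_plus_contract:
  assumes "x \<ge> 0" "y \<ge> (0::real)"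
  shows "\<bar>1 / (2 + x) - 1 / (2 + y)\<bar> \<le> \<bar>x - y\<bar> / 4"
proof -
  have "1 / (2 + x) - 1 / (2 + y) = (y - x) / ((2 + x) * (2 + y))" using assms by (simp add: field_simps)
  then have "\<bar>1 / (2 + x) - 1 / (2 + y)\<bar> = \<bar>x - y\<bar> / ((2 + x) * (2 + y))"
    using assms by (simp add: abs_minus_commute)
  also have "\<dots> \<le> \<bar>x - y\<bar> / 4"
  proof (rule divide_left_mono)
    have "2 * 2 \<le> (2 + x) * (2 + y)" using assms by (intro mult_mono) auto
    then show "4 \<le> (2 + x) * (2 + y)" by simp
  qed (use assms in auto)
  finally show ?thesis .
qed

lemma equal_runs:
  assumes C: "gauss_closed C" and two: "around_two C y z"
    and v: "golden < v" "v < 1" "y = ones (2 * s + 1) (1 / (2 + v))"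
    and w: "golden < w" "w < 1" "z = ones (2 * t + 1) (1 / (2 + w))"
  shows "s = t"
  using longer_run_impossible[OF v(1,2) w(1,2) v(3) w(3) around_twoD(2)[OF C two]]
    longer_run_impossible[OF w(1,2) v(1,2) w(3) v(3) around_twoD(1)[OF C two]] by simp

text \<open>
  By \<open>equal_runs\<close> the length of the run before a digit 2 propagates to the run after it, hence to all
  later runs; each run contracts distances by a factor of at least 4.
\<close>

lemma near_periodic_tail:
  assumes C: "gauss_closed C" and two: "around_two C y z"
    and v: "golden < v" "v < 1" "y = ones (2 * t + 1) (1 / (2 + v))"
  shows "\<bar>z - periodic_tail (Suc t)\<bar> \<le> (1/4) ^ n"
  using two v
proof (induction n arbitrary: y z v)
  case 0
  then show ?case using around_twoD(5,6)[OF C 0(1)] periodic_tail_bounds[of t] golden_bounds by auto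
next
  case (Suc n)
  obtain s w where w: "z = ones (2 * s + 1) (1 / (2 + w))"
    "around_two C (ones (2 * s + 1) (1 / (2 + y))) w"
    using next_around_two[OF C Suc.prems(1)] by blast
  note D = around_twoD[OF C Suc.prems(1)] and E = around_twoD[OF C w(2)]
  have st: "s = t" using equal_runs[OF C Suc.prems(1) Suc.prems(2-4) E(5,6) w(1)] by simp
  have "\<bar>w - periodic_tail (Suc t)\<bar> \<le> (1/4) ^ n"
    using Suc.IH[OF w(2)[unfolded st] D(3,4)] by simp
  moreover have "\<bar>z - periodic_tail (Suc t)\<bar> \<le> \<bar>1 / (2 + w) - 1 / (2 + periodic_tail (Suc t))\<bar>"
    using ones_lipschitz[of "1 / (2 + w)" "1 / (2 + periodic_tail (Suc t))" "2 * t + 1"]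
      periodic_tail_bounds[of t] E(5) golden_bounds periodic_tail_fixed[of t] by (simp add: w(1) st)
  moreover have "\<bar>1 / (2 + w) - 1 / (2 + periodic_tail (Suc t))\<bar> \<le> \<bar>w - periodic_tail (Suc t)\<bar> / 4"
    using periodic_tail_bounds[of t] E(5) golden_bounds by (intro inverse_2_plus_contract) auto
  ultimately show ?case by simp
qed

lemma around_two_eq_periodic_tail:
  assumes C: "gauss_closed C" and two: "around_two C y z"
  shows "\<exists>t. z = periodic_tail (Suc t)"
proof -
  obtain t v where v: "z = ones (2 * t + 1) (1 / (2 + v))"
    "around_two C (ones (2 * t + 1) (1 / (2 + y))) v"
    using next_around_two[OF C two] by blast
  note D = around_twoD[OF C two]
  have "v = periodic_tail (Suc t)"
  proof (rule ccontr)
    assume "v \<noteq> periodic_tail (Suc t)"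
    then obtain n where "(1/4) ^ n < \<bar>v - periodic_tail (Suc t)\<bar>"
      using real_arch_pow_inv[of "\<bar>v - periodic_tail (Suc t)\<bar>" "1/4"] by auto
    then show False using near_periodic_tail[OF C v(2) D(3,4) refl, of n] by simp
  qed
  then show ?thesis using v(1) periodic_tail_fixed by auto
qed

text \<open>
  Without a digit 2 in either direction both halves are \<open>golden\<close>. Around a digit 2 both tails are
  periodic, and equality of adjacent runs makes them the same periodic tail.
\<close>

lemma gauss_closed_classification:
  assumes C: "gauss_closed C" and C': "gauss_closed (C\<inverse>)" and mem: "(\<theta>, \<phi>) \<in> C"
  shows "(golden, golden) \<in> C \<or> (\<exists>t. (1 / (2 + periodic_tail (Suc t)), periodic_tail (Suc t)) \<in> C)"
proof -
  have tails: "\<exists>t. (1 / (2 + periodic_tail (Suc t)), periodic_tail (Suc t)) \<in> C" if two: "around_two C y z" for y z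
  proof -
    have two': "around_two (C\<inverse>) z y" using two by (simp add: around_two_converse)
    obtain t s where t: "z = periodic_tail (Suc t)" and s: "y = periodic_tail (Suc s)"
      using around_two_eq_periodic_tail[OF C two] around_two_eq_periodic_tail[OF C' two'] by blast
    note D = around_twoD[OF C two]
    have "s = t"
      using equal_runs[OF C two, of y s z t] D periodic_tail_fixed[of s] periodic_tail_fixed[of t] by (simp add: s t)
    then show ?thesis using two unfolding around_two_def s t by auto
  qed
  consider "\<theta> = golden" "\<phi> = golden" | "\<theta> \<noteq> golden" | "\<phi> \<noteq> golden" by blast
  then show ?thesis
  proof cases
    case 1
    then show ?thesis using mem by simp
  next
    case 2
    then show ?thesis using next_two[OF C mem] tails unfolding around_two_def by blast
  next
    case 3
    have "(\<phi>, \<theta>) \<in> C\<inverse>" using mem by simp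
    from next_two[OF C' this 3] show ?thesis using tails unfolding around_two_def by blast
  qed
qed

section \<open>The bottom of the spectrum\<close>

lemma golden_threshold: "1 / (1 + (2 * golden - 1)) = (1 + sqrt 5) / 4"
  by (simp add: golden_def field_simps)

definition orbit :: "(real^2) set \<Rightarrow> (real \<times> real) set" where
  "orbit L = {(\<theta>, \<phi>). 0 < \<theta> \<and> \<theta> < 1 \<and> 0 < \<phi> \<and> \<phi> < 1 \<and> (\<exists>p q. cell L \<theta> \<phi> p q)}"

lemma cell_product_gt:
  assumes small: "mordell_constant L < (1 + sqrt 5) / 4" and c: "cell L \<theta> \<phi> p q"
  shows "2 * golden - 1 < \<theta> * \<phi>"
proof -
  have "1 / (1 + \<theta> * \<phi>) < 1 / (1 + (2 * golden - 1))"
    using cell_le_mordell_constant[OF c] small golden_threshold by simp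
  moreover have "\<theta> * \<phi> \<ge> 0" using c by (simp add: cell_def)
  ultimately show ?thesis using golden_bounds by (simp add: field_simps)
qed

text \<open>
  The step with \<open>a = \<lfloor>1 / \<theta>\<rfloor>\<close>. The threshold on the products rules out that the expansion
  terminates. A cell with \<open>\<theta> = 1\<close> or \<open>\<phi> = 1\<close> lies outside the orbit, but one step leads into it.
\<close>

lemma cell_next_in_orbit:
  assumes small: "mordell_constant L < (1 + sqrt 5) / 4" and c: "cell L \<theta> \<phi> p q" and le: "\<theta> \<le> 1"
  shows "\<exists>a::int \<ge> 1. \<exists>z. \<theta> = 1 / (of_int a + z) \<and> (z, 1 / (of_int a + \<phi>)) \<in> orbit L"
proof -
  have "0 < \<theta> * \<phi>" using cell_product_gt[OF small c] golden_bounds by simp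
  then have pos: "0 < \<theta>" "0 < \<phi>" using c by (auto simp: cell_def zero_less_mult_iff)
  define a where "a = \<lfloor>1 / \<theta>\<rfloor>"
  define z where "z = 1 / \<theta> - of_int a"
  have a: "1 \<le> a" "of_int a \<le> 1 / \<theta>" using pos le by (auto simp: a_def le_floor_iff)
  have z: "z < 1" unfolding z_def a_def by linarith
  \<comment> \<open>The new cell is again above the threshold, so \<open>z\<close> cannot vanish.\<close>
  have step: "cell L z (1 / (of_int a + \<phi>)) (\<theta> * p) (q * (of_int a + \<phi>))"
    unfolding z_def using cell_step[OF c pos(1) a] .
  have ap: "1 < of_int a + \<phi>" using a(1) pos by linarith
  then have pos': "0 < 1 / (of_int a + \<phi>)" by simp
  have "0 < z * (1 / (of_int a + \<phi>))" using cell_product_gt[OF small step] golden_bounds by simp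
  then have "0 < z" using pos' by (simp only: zero_less_mult_pos2)
  then have "(z, 1 / (of_int a + \<phi>)) \<in> orbit L" using z ap pos' step unfolding orbit_def by auto
  moreover have "\<theta> = 1 / (of_int a + z)" by (simp add: z_def)
  ultimately show ?thesis using a(1) by blast
qed

lemma gauss_closed_orbit:
  assumes "mordell_constant L < (1 + sqrt 5) / 4"
  shows "gauss_closed (orbit L)"
  unfolding gauss_closed_def
proof clarify
  fix \<theta> \<phi> assume "(\<theta>, \<phi>) \<in> orbit L"
  then obtain p q where b: "0 < \<theta>" "\<theta> < 1" "0 < \<phi>" "\<phi> < 1" and c: "cell L \<theta> \<phi> p q"
    by (auto simp: orbit_def)
  show "0 < \<theta> \<and> \<theta> < 1 \<and> 0 < \<phi> \<and> \<phi> < 1 \<and> 2 * golden - 1 < \<theta> * \<phi> \<and>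
     (\<exists>a::int \<ge> 1. \<exists>z. \<theta> = 1 / (of_int a + z) \<and> (z, 1 / (of_int a + \<phi>)) \<in> orbit L)"
    using b cell_product_gt[OF assms c] cell_next_in_orbit[OF assms c] by simp
qed

lemma orbit_swap: "orbit (swap ` L) = (orbit L)\<inverse>"
proof -
  have "(\<exists>p q. cell (swap ` L) \<theta> \<phi> p q) \<longleftrightarrow> (\<exists>p q. cell L \<phi> \<theta> p q)" for \<theta> \<phi>
    using cell_swap[of L \<phi> \<theta>] cell_swap[of "swap ` L" \<theta> \<phi>]
    unfolding swap_image_swap_image by blast
  then show ?thesis by (auto simp: orbit_def)
qed

definition spectral_value :: "nat \<Rightarrow> real" where
  "spectral_value t = (1 + sqrt (real (fib (2 * t)) / real (fib (2 * t + 2)))) / 2"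

lemma mordell_constant_golden:
  assumes "cell L golden golden p q"
  shows "mordell_constant L = (5 + sqrt 5) / 10"
proof -
  have "mordell_constant L = 1 / (1 + golden * golden)"
    using mordell_constant_closed_orbit[OF closed_orbit_golden assms] by simp
  also have "\<dots> = 1 / (2 - golden)" by (simp add: golden_sq)
  also have "\<dots> = (5 + sqrt 5) / 10"
  proof -
    have "(5 + sqrt 5) / 10 * (2 - golden) = 1" by (simp add: golden_def field_simps)
    then show ?thesis using golden_bounds by (simp add: divide_eq_eq)
  qed
  finally show ?thesis .
qed

lemma mordell_constant_periodic:
  assumes "cell L (1 / (2 + periodic_tail (Suc k))) (periodic_tail (Suc k)) p q"
  shows "mordell_constant L = spectral_value (Suc k)"
proof -
  let ?u = "1 / (2 + periodic_tail (Suc k))"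
  have "(ones 0 ?u, ones (2 * k + 1) ?u) \<in> {(ones i ?u, ones j ?u) | i j. i + j = 2 * k + 1}"
    by (intro CollectI exI[of _ 0] exI[of _ "2 * k + 1"]) simp
  then have "(?u, periodic_tail (Suc k)) \<in> {(ones i ?u, ones j ?u) | i j. i + j = 2 * k + 1}"
    by (simp only: periodic_tail_fixed ones_0)
  then show ?thesis
    using mordell_constant_closed_orbit[OF closed_orbit_periodic assms]
    unfolding periodic_tail_value spectral_value_def by blast
qed

lemma mordell_constant_single_two:
  assumes "cell L (1 / (2 + golden)) golden p q"
  shows "mordell_constant L = (1 + sqrt 5) / 4"
proof -
  let ?u = "1 / (2 + golden)"
  have "(ones 0 ?u, golden) \<in> range (\<lambda>i. (golden, ones i ?u)) \<union> range (\<lambda>i. (ones i ?u, golden))"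
    by blast
  then have "mordell_constant L = 1 / (1 + ?u * golden)"
    using mordell_constant_closed_orbit[OF closed_orbit_single_two assms] by simp
  also have "?u * golden = 2 * golden - 1"
  proof -
    have "golden = (2 * golden - 1) * (2 + golden)" using golden_sq by (simp add: algebra_simps)
    then show ?thesis using golden_bounds by (simp add: divide_eq_eq)
  qed
  finally show ?thesis by (simp only: golden_threshold)
qed

lemma MG2_below_threshold:
  assumes "z \<in> MG2" "z < (1 + sqrt 5) / 4"
  shows "z = (5 + sqrt 5) / 10 \<or> (\<exists>t\<ge>1. z = spectral_value t)"
proof -
  obtain L where L: "unimodular_lattice L" and z: "z = mordell_constant L"
    using assms(1) by (auto simp: MG2_def)
  have small: "mordell_constant L < (1 + sqrt 5) / 4" using assms(2) z by simp
  have small': "mordell_constant (swap ` L) < (1 + sqrt 5) / 4"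
    using small mordell_constant_swap[OF unimodular_lattice_zero[OF L]] by simp
  obtain \<theta> \<phi> p q where c: "cell L \<theta> \<phi> p q" "\<theta> \<le> 1"
    using unimodular_has_cell[OF L] by blast
  obtain \<theta>' \<phi>' where mem: "(\<theta>', \<phi>') \<in> orbit L"
    using cell_next_in_orbit[OF small c] by blast
  have "(golden, golden) \<in> orbit L \<or> (\<exists>t. (1 / (2 + periodic_tail (Suc t)), periodic_tail (Suc t)) \<in> orbit L)"
    using gauss_closed_classification[OF gauss_closed_orbit[OF small] _ mem]
      gauss_closed_orbit[OF small'] unfolding orbit_swap by blast
  then show ?thesis
  proof
    assume "(golden, golden) \<in> orbit L"
    then show ?thesis using mordell_constant_golden z by (auto simp: orbit_def)
  next
    assume "\<exists>t. (1 / (2 + periodic_tail (Suc t)), periodic_tail (Suc t)) \<in> orbit L"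
    then obtain t where "(1 / (2 + periodic_tail (Suc t)), periodic_tail (Suc t)) \<in> orbit L" by blast
    then have "z = spectral_value (Suc t)" using mordell_constant_periodic z by (auto simp: orbit_def)
    then show ?thesis by (intro disjI2 exI[of _ "Suc t"]) auto
  qed
qed

lemma cell_mordell_constant_in_MG2: "cell L \<theta> \<phi> p q \<Longrightarrow> mordell_constant L \<in> MG2"
  unfolding MG2_def using cell_unimodular by blast

lemma minimum_in_MG2: "(5 + sqrt 5) / 10 \<in> MG2"
proof -
  obtain L p q where c: "cell L golden golden p q"
    using exists_cell[of golden golden] golden_bounds by auto
  show ?thesis using cell_mordell_constant_in_MG2[OF c] unfolding mordell_constant_golden[OF c] .
qed

lemma threshold_in_MG2: "(1 + sqrt 5) / 4 \<in> MG2"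
proof -
  obtain L p q where c: "cell L (1 / (2 + golden)) golden p q"
    using exists_cell[of "1 / (2 + golden)" golden] golden_bounds by auto
  show ?thesis using cell_mordell_constant_in_MG2[OF c] unfolding mordell_constant_single_two[OF c] .
qed

lemma spectral_value_in_MG2:
  assumes "t \<ge> 1"
  shows "spectral_value t \<in> MG2"
proof -
  obtain k where k: "t = Suc k" using assms by (cases t) auto
  obtain L p q where c: "cell L (1 / (2 + periodic_tail (Suc k))) (periodic_tail (Suc k)) p q"
    using exists_cell[of "1 / (2 + periodic_tail (Suc k))" "periodic_tail (Suc k)"] periodic_tail_bounds[of k] by auto
  show ?thesis
    using cell_mordell_constant_in_MG2[OF c] unfolding mordell_constant_periodic[OF c] k .
qed

text \<open>
  Multiplying by the golden ratio, this is \<open>F (n + 1) - \<Phi> F n = (- golden) ^ n\<close>, where \<open>\<Phi>\<close> is that ratio.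
\<close>

lemma fib_ratio_golden: "golden * real (fib (Suc n)) = real (fib n) + golden * (- golden) ^ n"
proof (induction n rule: fib.induct)
  case (3 n)
  have gg: "golden * (golden * x) = x - golden * x" for x
    unfolding mult.assoc[symmetric] golden_sq by (simp add: algebra_simps)
  show ?case using "3.IH" by (simp add: algebra_simps gg)
next
  case 2
  show ?case using golden_sq by simp
qed simp

lemma fib_even_ratio:
  "real (fib (2 * t)) / real (fib (2 * t + 2)) = golden\<^sup>2 - golden ^ (2 * t + 2) / real (fib (2 * t + 2))"
proof -
  define e where "e = golden ^ (2 * t)"
  have pos: "real (fib (2 * t + 2)) > 0" using fib_neq_0_nat[of "2 * t + 2"] by (simp del: fib.simps)
  have 1: "golden * real (fib (2 * t + 1)) = real (fib (2 * t)) + golden * e"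
    using fib_ratio_golden[of "2 * t"] by (simp add: e_def)
  have 2: "real (fib (2 * t + 2)) = real (fib (2 * t + 1)) + real (fib (2 * t))" by simp
  have "golden * golden * real (fib (2 * t + 2)) = golden * (golden * real (fib (2 * t + 1))) + golden * golden * real (fib (2 * t))"
    by (simp only: 2 distrib_left mult.assoc)
  also have "\<dots> = golden * real (fib (2 * t)) + golden * golden * e + golden * golden * real (fib (2 * t))"
    by (simp only: 1) (simp add: algebra_simps)
  also have "\<dots> = real (fib (2 * t)) + golden * golden * e"
    unfolding golden_sq by (simp add: algebra_simps)
  finally have "real (fib (2 * t)) = golden\<^sup>2 * real (fib (2 * t + 2)) - golden ^ (2 * t + 2)"
    by (simp add: e_def power2_eq_square)
  then have "real (fib (2 * t)) / real (fib (2 * t + 2)) =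
      (golden\<^sup>2 * real (fib (2 * t + 2)) - golden ^ (2 * t + 2)) / real (fib (2 * t + 2))"
    by (simp only:)
  also have "\<dots> = golden\<^sup>2 - golden ^ (2 * t + 2) / real (fib (2 * t + 2))"
    using pos by (simp add: diff_divide_distrib del: fib.simps)
  finally show ?thesis .
qed

lemma threshold_golden: "(1 + sqrt 5) / 4 = (1 + golden) / 2"
  by (simp add: golden_def field_simps)

lemma spectral_value_less:
  "spectral_value t < (1 + sqrt 5) / 4"
proof -
  have "golden ^ (2 * t + 2) / real (fib (2 * t + 2)) > 0"
    using golden_bounds fib_neq_0_nat[of "2 * t + 2"]
    by (intro divide_pos_pos zero_less_power) (auto simp del: fib.simps)
  then have "real (fib (2 * t)) / real (fib (2 * t + 2)) < golden\<^sup>2"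
    using fib_even_ratio[of t] by linarith
  then have "sqrt (real (fib (2 * t)) / real (fib (2 * t + 2))) < golden"
    using golden_bounds by (intro real_less_lsqrt) auto
  then show ?thesis unfolding spectral_value_def threshold_golden by simp
qed

lemma spectral_value_greater:
  assumes "t \<ge> 1"
  shows "(5 + sqrt 5) / 10 < spectral_value t"
proof -
  obtain k where k: "t = Suc k" using assms by (cases t) auto
  define a b where "a = real (fib (2 * t))" and "b = real (fib (2 * t + 2))"
  have "fib (2 * t + 2) \<le> 4 * fib (2 * t)" unfolding k by simp
  then have ab: "b \<le> 4 * a" unfolding a_def b_def by linarith
  have b: "b > 0" using fib_neq_0_nat[of "2 * t + 2"] unfolding b_def by (simp del: fib.simps)
  have "(1/2)\<^sup>2 \<le> a / b" using ab b by (simp add: power2_eq_square field_simps)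
  then have "1/2 \<le> sqrt (a / b)" by (rule real_le_rsqrt)
  moreover have "(5 + sqrt 5) / 10 = (1 + (1 + 2 * golden) / 5) / 2" by (simp add: golden_def field_simps)
  ultimately show ?thesis using golden_bounds unfolding spectral_value_def a_def b_def by simp
qed

lemma spectral_value_tendsto: "spectral_value \<longlonglongrightarrow> (1 + sqrt 5) / 4"
proof -
  have "(\<lambda>t. golden ^ (2 * t + 2) / real (fib (2 * t + 2))) \<longlonglongrightarrow> 0"
  proof (rule tendsto_sandwich)
    show "\<forall>\<^sub>F t in sequentially. 0 \<le> golden ^ (2 * t + 2) / real (fib (2 * t + 2))"
      using golden_bounds by (intro always_eventually allI divide_nonneg_nonneg zero_le_power) auto
    show "\<forall>\<^sub>F t in sequentially. golden ^ (2 * t + 2) / real (fib (2 * t + 2)) \<le> golden ^ t"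
    proof (intro always_eventually allI)
      fix t
      have "fib (2 * t + 2) \<ge> 1" using fib_neq_0_nat[of "2 * t + 2"] by linarith
      then have "real (fib (2 * t + 2)) \<ge> 1" by linarith
      then have "golden ^ (2 * t + 2) / real (fib (2 * t + 2)) \<le> golden ^ (2 * t + 2) / 1"
        using golden_bounds by (intro divide_left_mono) auto
      also have "\<dots> \<le> golden ^ t"
        using golden_bounds by (simp, intro power_decreasing[of t "2 * t + 2", simplified]) auto
      finally show "golden ^ (2 * t + 2) / real (fib (2 * t + 2)) \<le> golden ^ t" .
    qed
    show "(\<lambda>t. golden ^ t) \<longlonglongrightarrow> 0" using golden_bounds by (intro LIMSEQ_realpow_zero) auto
  qed simp
  then have "(\<lambda>t. (1 + sqrt (golden\<^sup>2 - golden ^ (2 * t + 2) / real (fib (2 * t + 2)))) / 2)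
      \<longlonglongrightarrow> (1 + sqrt (golden\<^sup>2 - 0)) / 2"
    by (intro tendsto_intros) (auto simp del: fib.simps)
  moreover have "(1 + sqrt (golden\<^sup>2 - 0)) / 2 = (1 + sqrt 5) / 4"
    using golden_bounds by (simp add: threshold_golden)
  ultimately show ?thesis
    unfolding spectral_value_def[abs_def] fib_even_ratio by (simp only:)
qed

lemma finite_MG2_below:
  assumes "m < (1 + sqrt 5) / 4"
  shows "finite (MG2 \<inter> {..<m})"
proof -
  have "\<forall>\<^sub>F t in sequentially. m < spectral_value t"
    using spectral_value_tendsto assms by (rule order_tendstoD)
  then obtain N where N: "\<And>t. t \<ge> N \<Longrightarrow> m < spectral_value t"
    by (auto simp: eventually_sequentially)
  have "MG2 \<inter> {..<m} \<subseteq> insert ((5 + sqrt 5) / 10) (spectral_value ` {..<N})"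
  proof
    fix z assume z: "z \<in> MG2 \<inter> {..<m}"
    then have "z = (5 + sqrt 5) / 10 \<or> (\<exists>t\<ge>1. z = spectral_value t)"
      using assms by (intro MG2_below_threshold) auto
    then show "z \<in> insert ((5 + sqrt 5) / 10) (spectral_value ` {..<N})"
      using z N by (force simp: not_le[symmetric])
  qed
  then show ?thesis by (rule finite_subset) simp
qed

lemma not_islimpt_MG2_below:
  assumes "z < (1 + sqrt 5) / 4"
  shows "\<not> z islimpt MG2"
proof
  assume lim: "z islimpt MG2"
  obtain m where m: "z < m" "m < (1 + sqrt 5) / 4" using dense[OF assms] by blast
  have "z islimpt (MG2 \<inter> {..<m})"
    using lim m(1) by (intro islimpt_Int_eventually) (auto intro: eventually_at_in_open' order_tendstoD)
  then show False using finite_MG2_below[OF m(2)] islimpt_finite by blast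
qed

lemma threshold_islimpt_MG2: "(1 + sqrt 5) / 4 islimpt MG2"
  unfolding islimpt_sequential
proof (intro exI conjI allI)
  show "spectral_value (Suc n) \<in> MG2 - {(1 + sqrt 5) / 4}" for n
    using spectral_value_in_MG2[of "Suc n"] spectral_value_less[of "Suc n"] by auto
  show "(\<lambda>n. spectral_value (Suc n)) \<longlonglongrightarrow> (1 + sqrt 5) / 4"
    using spectral_value_tendsto by (rule LIMSEQ_Suc)
qed

theorem theorem29:
  shows "((5 + sqrt 5) / 10 \<in> MG2 \<and> (\<forall>z\<in>MG2. (5 + sqrt 5) / 10 \<le> z)) \<and>
    MG2 \<inter> {(5 + sqrt 5) / 10 <..< (1 + sqrt 5) / 4} =
      {(1 + sqrt (real (fib (2 * t)) / real (fib (2 * t + 2)))) / 2 | t :: nat. t \<ge> 1} \<and>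
    ((1 + sqrt 5) / 4 islimpt MG2 \<and> (\<forall>z. z islimpt MG2 \<longrightarrow> (1 + sqrt 5) / 4 \<le> z)) \<and>
    (1 + sqrt 5) / 4 \<in> MG2"
proof (intro conjI)
  show "(5 + sqrt 5) / 10 \<in> MG2" by (rule minimum_in_MG2)
  show "\<forall>z\<in>MG2. (5 + sqrt 5) / 10 \<le> z"
  proof
    fix z assume z: "z \<in> MG2"
    show "(5 + sqrt 5) / 10 \<le> z"
    proof (cases "z < (1 + sqrt 5) / 4")
      case True
      then show ?thesis using MG2_below_threshold[OF z] spectral_value_greater by force
    next
      case False
      then show ?thesis
        using spectral_value_greater[OF order_refl] spectral_value_less[of 1] by linarith
    qed
  qed
  show "MG2 \<inter> {(5 + sqrt 5) / 10 <..< (1 + sqrt 5) / 4} =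
      {(1 + sqrt (real (fib (2 * t)) / real (fib (2 * t + 2)))) / 2 | t :: nat. t \<ge> 1}"
    unfolding spectral_value_def[symmetric]
    using MG2_below_threshold spectral_value_in_MG2 spectral_value_greater spectral_value_less
    by fastforce
  show "(1 + sqrt 5) / 4 islimpt MG2" by (rule threshold_islimpt_MG2)
  show "\<forall>z. z islimpt MG2 \<longrightarrow> (1 + sqrt 5) / 4 \<le> z" using not_islimpt_MG2_below not_le by blast
  show "(1 + sqrt 5) / 4 \<in> MG2" by (rule threshold_in_MG2)
qed

end
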